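(* Let $n\ge1$ be an integer, $E$ a finite-dimensional real inner product space, and $\gamma\in[0,n)$. Let $X$ be a stationary $E$-valued Gaussian random field on $\mathbb{T}^n$ whose covariance is represented by an integrable kernel $C$ on $\mathbb{T}^n$, i.e. $\mathrm{Cov}(\langle X,\phi\rangle,\langle X,\psi\rangle)=\langle\phi,C*\psi\rangle$ for all $\phi,\psi\in C^\infty(\mathbb{T}^n;E)$, satisfying $$\sup_{x\in\mathbb{T}^n\setminus\{0\}}|x|^\gamma|C(x)|<\infty.$$ Then $X$ satisfies the spectral gap inequality with $L^s$-norm for any $s>\frac{2n}{2n-\gamma}$. If $\gamma=0$, one can take $s=1$.
   Context: $\mathbb{T}^n=\mathbb{R}^n/\mathbb{Z}^n$; $|x|$ for $x\in\mathbb{T}^n$ is the geodesic distance from $0$. A random field is a random element of $\mathcal{D}'(\mathbb{T}^n;E)$; it is stationary if its law is invariant under all translations. $C$ takes values in the linear maps $E\to E$ (a scalar kernel being identified with a multiple of the identity), $|C(x)|$ is the operator norm, and $(C*\psi)(x)=\int_{\mathbb{T}^n}C(x-y)\psi(y)\,dy$. Spectral gap inequality. Write $\mathcal{D}(\mathbb{T}^n;E)=C^\infty(\mathbb{T}^n;E)$. $G\colon\mathcal{D}'(\mathbb{T}^n;E)\to\mathbb{R}$ is cylindrical if $G(\xi)=f(\xi(\phi_1),\dots,\xi(\phi_m))$ with $m\in\mathbb{N}$, $\phi_i\in\mathcal{D}(\mathbb{T}^n;E)$, $f\colon\mathbb{R}^m\to\mathbb{R}$ smooth; $\frac{\delta G}{\delta\xi}=\sum_i\partial_if(\xi(\phi_1),\dots,\xi(\phi_m))\phi_i$.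 A random distribution $\xi$ satisfies the spectral gap inequality with norm $\|\cdot\|$ on $\mathcal{D}(\mathbb{T}^n;E)$ if there is a constant $K$ such that for all bounded cylindrical $G$, $(\mathbb{E}|G(\xi)|^2)^{1/2}\le K\big(|\mathbb{E}[G(\xi)]|+(\mathbb{E}\|\frac{\delta G}{\delta\xi}\|^2)^{1/2}\big)$. "With $L^s$-norm" means $\|\cdot\|$ is the $L^s(\mathbb{T}^n;E)$-norm. *)

theory Defs
  imports "HOL-Probability.Probability"
begin

section \<open>The torus\<close>

text \<open>
  Functions on the torus \<open>\<real>\<^sup>n / \<int>\<^sup>n\<close> are represented by \<open>\<int>\<^sup>n\<close>-periodic functions on
  \<^typ>\<open>real ^ 'n\<close>, and integrals over the torus by integrals over a fundamental domain.
\<close>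

definition int_lattice :: "(real ^ 'n) set" where
  "int_lattice = {k. \<forall>i. k $ i \<in> \<int>}"

definition torus_periodic :: "(real ^ 'n \<Rightarrow> 'b) \<Rightarrow> bool" where
  "torus_periodic f \<longleftrightarrow> (\<forall>x. \<forall>k\<in>int_lattice. f (x + k) = f x)"

text \<open>The geodesic distance on the flat torus from the class of \<open>x\<close> to \<open>0\<close>.\<close>

definition torus_abs :: "real ^ 'n \<Rightarrow> real" where
  "torus_abs x = infdist x int_lattice"

definition torus_measure :: "(real ^ 'n) measure" where
  "torus_measure = lebesgue_on (cbox 0 1)"

definition Ls_norm :: "real \<Rightarrow> (real ^ 'n \<Rightarrow> 'e::euclidean_space) \<Rightarrow> real" where
  "Ls_norm s \<phi> = (\<integral>x. norm (\<phi> x) powr s \<partial>torus_measure) powr (1 / s)"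

definition torus_convolution ::
    "(real ^ 'n \<Rightarrow> 'e \<Rightarrow>\<^sub>L 'e) \<Rightarrow> (real ^ 'n \<Rightarrow> 'e) \<Rightarrow> real ^ 'n \<Rightarrow> 'e::euclidean_space" where
  "torus_convolution C \<psi> x = (\<integral>y. blinfun_apply (C (x - y)) (\<psi> y) \<partial>torus_measure)"

definition torus_inner ::
    "(real ^ 'n \<Rightarrow> 'e::euclidean_space) \<Rightarrow> (real ^ 'n \<Rightarrow> 'e) \<Rightarrow> real" where
  "torus_inner \<phi> \<psi> = (\<integral>x. \<phi> x \<bullet> \<psi> x \<partial>torus_measure)"


section \<open>Test functions and distributions\<close>

definition dir_deriv ::
    "real ^ 'n \<Rightarrow> (real ^ 'n \<Rightarrow> 'e) \<Rightarrow> real ^ 'n \<Rightarrow> 'e::euclidean_space" where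
  "dir_deriv v \<phi> = (\<lambda>x. frechet_derivative \<phi> (at x) v)"

text \<open>The iterated partial derivatives of \<open>\<phi>\<close> are \<open>foldr dir_deriv vs \<phi>\<close> with \<open>vs\<close> a list
  of standard basis vectors.\<close>

definition test_functions :: "(real ^ 'n \<Rightarrow> 'e::euclidean_space) set" where
  "test_functions = {\<phi>. torus_periodic \<phi> \<and>
     (\<forall>vs\<in>lists Basis. \<forall>x. foldr dir_deriv vs \<phi> differentiable (at x))}"

definition Ck_norm :: "nat \<Rightarrow> (real ^ 'n \<Rightarrow> 'e::euclidean_space) \<Rightarrow> real" where
  "Ck_norm k \<phi> = (\<Sum>vs\<in>{vs\<in>lists Basis. length vs \<le> k}. SUP x. norm (foldr dir_deriv vs \<phi> x))"

text \<open>
  Distributions are the linear functionals on the test functions that are continuous for the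
  Frechet topology, i.e. bounded by a multiple of some \<open>C\<^sup>k\<close> norm. Requiring them to be
  \<^const>\<open>extensional\<close> makes a distribution determined by its values on test functions.
\<close>

definition distributions :: "((real ^ 'n \<Rightarrow> 'e::euclidean_space) \<Rightarrow> real) set" where
  "distributions = {\<xi> \<in> extensional test_functions.
     (\<forall>\<phi>\<in>test_functions. \<forall>\<psi>\<in>test_functions. \<xi> (\<lambda>x. \<phi> x + \<psi> x) = \<xi> \<phi> + \<xi> \<psi>) \<and>
     (\<forall>c. \<forall>\<phi>\<in>test_functions. \<xi> (\<lambda>x. c *\<^sub>R \<phi> x) = c * \<xi> \<phi>) \<and>
     (\<exists>k K. \<forall>\<phi>\<in>test_functions. \<bar>\<xi> \<phi>\<bar> \<le> K * Ck_norm k \<phi>)}"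

text \<open>The space of distributions with the sigma-algebra generated by the evaluations
  \<open>\<xi> \<mapsto> \<xi> \<phi>\<close>; it is the Borel sigma-algebra of both the weak and the strong dual topology.\<close>

definition distribution_space :: "((real ^ 'n \<Rightarrow> 'e::euclidean_space) \<Rightarrow> real) measure" where
  "distribution_space = restrict_space (\<Pi>\<^sub>M \<phi>\<in>test_functions. borel) distributions"

definition translate ::
    "real ^ 'n \<Rightarrow> ((real ^ 'n \<Rightarrow> 'e::euclidean_space) \<Rightarrow> real) \<Rightarrow> (real ^ 'n \<Rightarrow> 'e) \<Rightarrow> real" where
  "translate h \<xi> = (\<lambda>\<phi>\<in>test_functions. \<xi> (\<lambda>x. \<phi> (x + h)))"


section \<open>Random fields\<close>

definition random_field ::
    "'w measure \<Rightarrow> ('w \<Rightarrow> (real ^ 'n \<Rightarrow> 'e::euclidean_space) \<Rightarrow> real) \<Rightarrow> bool" where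
  "random_field M X \<longleftrightarrow> X \<in> M \<rightarrow>\<^sub>M distribution_space"

definition stationary ::
    "'w measure \<Rightarrow> ('w \<Rightarrow> (real ^ 'n \<Rightarrow> 'e::euclidean_space) \<Rightarrow> real) \<Rightarrow> bool" where
  "stationary M X \<longleftrightarrow>
     (\<forall>h. distr M distribution_space (\<lambda>w. translate h (X w)) = distr M distribution_space X)"

text \<open>Degenerate (almost surely constant) variables count as Gaussian.\<close>

definition gaussian_variable :: "'w measure \<Rightarrow> ('w \<Rightarrow> real) \<Rightarrow> bool" where
  "gaussian_variable M Y \<longleftrightarrow>
     (\<exists>\<mu> \<sigma>. 0 < \<sigma> \<and> distributed M lborel Y (\<lambda>y. ennreal (normal_density \<mu> \<sigma> y))) \<or>
     (\<exists>\<mu>. AE w in M. Y w = \<mu>)"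

text \<open>By linearity of \<open>\<phi> \<mapsto> X w \<phi>\<close> this includes the joint Gaussianity of finite families;
  the mean is not required to vanish.\<close>

definition gaussian_field ::
    "'w measure \<Rightarrow> ('w \<Rightarrow> (real ^ 'n \<Rightarrow> 'e::euclidean_space) \<Rightarrow> real) \<Rightarrow> bool" where
  "gaussian_field M X \<longleftrightarrow> (\<forall>\<phi>\<in>test_functions. gaussian_variable M (\<lambda>w. X w \<phi>))"

definition covariance :: "'w measure \<Rightarrow> ('w \<Rightarrow> real) \<Rightarrow> ('w \<Rightarrow> real) \<Rightarrow> real" where
  "covariance M Y Z = (\<integral>w. (Y w - (\<integral>v. Y v \<partial>M)) * (Z w - (\<integral>v. Z v \<partial>M)) \<partial>M)"


section \<open>The spectral gap inequality\<close>

text \<open>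
  Since the number \<open>m\<close> of variables is quantified inside the inequality, functions on \<open>\<real>\<^sup>m\<close>
  are represented by functions on \<^typ>\<open>nat \<Rightarrow> real\<close> that depend only on the coordinates
  below \<open>m\<close>; for these, continuity in the product topology is continuity on \<open>\<real>\<^sup>m\<close>.
\<close>

definition coord_deriv :: "nat \<Rightarrow> ((nat \<Rightarrow> real) \<Rightarrow> real) \<Rightarrow> (nat \<Rightarrow> real) \<Rightarrow> real" where
  "coord_deriv i f = (\<lambda>x. deriv (\<lambda>t. f (x(i := t))) (x i))"

definition smooth_function :: "nat \<Rightarrow> ((nat \<Rightarrow> real) \<Rightarrow> real) \<Rightarrow> bool" where
  "smooth_function m f \<longleftrightarrow>
     (\<forall>x y. (\<forall>i<m. x i = y i) \<longrightarrow> f x = f y) \<and>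
     (\<forall>is\<in>lists {..<m}. continuous_on UNIV (foldr coord_deriv is f) \<and>
        (\<forall>i<m. \<forall>x. (\<lambda>t. foldr coord_deriv is f (x(i := t))) differentiable (at (x i))))"

definition cylindrical ::
    "nat \<Rightarrow> (nat \<Rightarrow> real ^ 'n \<Rightarrow> 'e::euclidean_space) \<Rightarrow> ((nat \<Rightarrow> real) \<Rightarrow> real) \<Rightarrow>
     (((real ^ 'n \<Rightarrow> 'e) \<Rightarrow> real) \<Rightarrow> real) \<Rightarrow> bool" where
  "cylindrical m \<phi> f G \<longleftrightarrow> (\<forall>i<m. \<phi> i \<in> test_functions) \<and> smooth_function m f \<and>
     (\<forall>\<xi>\<in>distributions. G \<xi> = f (\<lambda>i. \<xi> (\<phi> i)))"

definition cyl_deriv ::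
    "nat \<Rightarrow> (nat \<Rightarrow> real ^ 'n \<Rightarrow> 'e::euclidean_space) \<Rightarrow> ((nat \<Rightarrow> real) \<Rightarrow> real) \<Rightarrow>
     ((real ^ 'n \<Rightarrow> 'e) \<Rightarrow> real) \<Rightarrow> real ^ 'n \<Rightarrow> 'e" where
  "cyl_deriv m \<phi> f \<xi> = (\<lambda>x. \<Sum>i<m. coord_deriv i f (\<lambda>j. \<xi> (\<phi> j)) *\<^sub>R \<phi> i x)"

text \<open>\<open>(\<bbbE> |Y|\<^sup>2)\<^sup>1\<^sup>/\<^sup>2\<close> as an element of \<open>[0, \<infinity>]\<close>: the derivative of a
  bounded cylindrical function need not have a finite second moment.\<close>

definition rms :: "'w measure \<Rightarrow> ('w \<Rightarrow> real) \<Rightarrow> ennreal" where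
  "rms M Y = (let I = (\<integral>\<^sup>+w. ennreal (\<bar>Y w\<bar>\<^sup>2) \<partial>M)
              in if I = \<infinity> then \<infinity> else ennreal (sqrt (enn2real I)))"

definition spectral_gap ::
    "'w measure \<Rightarrow> ('w \<Rightarrow> (real ^ 'n \<Rightarrow> 'e::euclidean_space) \<Rightarrow> real) \<Rightarrow>
     ((real ^ 'n \<Rightarrow> 'e) \<Rightarrow> real) \<Rightarrow> bool" where
  "spectral_gap M X N \<longleftrightarrow> (\<exists>K::real. \<forall>m \<phi> f G.
     cylindrical m \<phi> f G \<longrightarrow> bounded (G ` distributions) \<longrightarrow>
     rms M (\<lambda>w. G (X w)) \<le>
       ennreal K * (ennreal \<bar>\<integral>w. G (X w) \<partial>M\<bar> + rms M (\<lambda>w. N (cyl_deriv m \<phi> f (X w)))))"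

end

theory Submission
  imports Defs
begin

text \<open>
  Two facts carry the theorem: a Gaussian Poincare inequality, and a bound of the variance of
  \<open>X(D)\<close> by \<open>\<parallel>D\<parallel>\<^sup>2\<close> in \<open>L\<^sup>s\<close> for a test function \<open>D\<close>.

  If \<open>G(X) = f(X(\<phi>\<^sub>1), \<dots>, X(\<phi>\<^sub>m))\<close>, the Poincare inequality bounds \<open>Var G(X)\<close> by a multiple of the
  expectation of \<open>v(\<nabla>f)\<close>, where \<open>v(a)\<close> is the variance of \<open>\<Sum>\<^sub>i a\<^sub>i X(\<phi>\<^sub>i)\<close>. By linearity \<open>v(\<nabla>f)\<close>, with the
  gradient frozen, is the variance of \<open>X(D)\<close> for \<open>D = \<delta>G/\<delta>\<xi>\<close>. So a bound
  \<open>Var X(D) \<le> \<Phi> \<parallel>D\<parallel>\<^sup>2\<close> is a spectral gap inequality (\<open>spectral_gapI\<close>).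

  The spectral gap inequality leaves its constant free, which permits the rotation argument of
  Maurey and Pisier. With an independent copy \<open>Y'\<close> of a Gaussian vector \<open>Y\<close>, the path
  \<open>Y\<^sub>\<theta> = cos \<theta> Y + sin \<theta> Y'\<close> joins \<open>Y\<close> to \<open>Y'\<close> and \<open>(Y\<^sub>\<theta>, dY\<^sub>\<theta>/d\<theta>)\<close> has the law of \<open>(Y, Y')\<close> for
  every \<open>\<theta>\<close> (\<open>gaussian_rotation_invariance\<close>). Integrating
  \<open>f(Y') - f(Y) = \<integral> \<nabla>f(Y\<^sub>\<theta>) \<cdot> dY\<^sub>\<theta>/d\<theta> d\<theta>\<close> over \<open>[0, \<pi>/2]\<close> and applying the Cauchy-Schwarz inequality gives
  the factor \<open>\<pi>\<^sup>2/8\<close> in \<open>gaussian_poincare\<close>, without diagonalising the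
  covariance. The invariance of the law rests on the uniqueness of multivariate
  characteristic functions (\<open>joint_law_eqI\<close>).

  The variance of \<open>X(D)\<close> is at most \<open>\<integral>\<integral> |D(x)| |C(x - y)| |D(y)| dy dx\<close>. Put \<open>r = s / (2 (s - 1))\<close>, so that
  \<open>2/s + 1/r = 2\<close>. For \<open>1 < s \<le> 2\<close> the elementary inequality
  \<open>a c b \<le> a\<^sup>s b\<^sup>s + (a\<^sup>s + b\<^sup>s) c\<^sup>r\<close> (\<open>young_pointwise\<close>), an additive form of the Young convolution
  inequality, bounds the double integral as soon as \<open>|C|\<^sup>r\<close> is integrable, uniformly over \<open>D\<close> with
  bounded \<open>L\<^sup>s\<close> norm, and scaling in \<open>D\<close> does the rest. As \<open>|C(z)|\<close> is at most of order \<open>|z|\<close> to the power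
  \<open>-\<gamma>\<close>, integrability follows from \<open>\<gamma> r < n\<close>, that is \<open>s > 2n / (2n - \<gamma>)\<close>; larger exponents follow because
  the torus has measure one. For \<open>\<gamma> = 0\<close> the kernel is bounded and \<open>s = 1\<close> is immediate.
\<close>

section \<open>Uniqueness of multivariate characteristic functions\<close>

text \<open>
  After division by their common total mass, the weighted laws of \<open>u\<close> and \<open>v\<close> are probability
  measures on the line with equal characteristic functions, so the one-dimensional uniqueness
  theorem of Levy applies.
\<close>

lemma weighted_law_eqI:
  fixes p u :: "'a \<Rightarrow> real" and q v :: "'b \<Rightarrow> real"
  assumes p: "integrable M p" "\<And>w. 0 \<le> p w" and u: "u \<in> borel_measurable M"
    and q: "integrable N q" "\<And>w. 0 \<le> q w" and v: "v \<in> borel_measurable N"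
    and char: "\<And>t. (CLINT w|M. p w *\<^sub>R iexp (t * u w)) = (CLINT w|N. q w *\<^sub>R iexp (t * v w))"
    and B: "B \<in> sets borel"
  shows "(\<integral>w. p w * indicat_real B (u w) \<partial>M) = (\<integral>w. q w * indicat_real B (v w) \<partial>N)"
proof -
  define c where "c = (\<integral>w. p w \<partial>M)"
  have "complex_of_real (\<integral>w. p w \<partial>M) = complex_of_real (\<integral>w. q w \<partial>N)"
    using char[of 0] by (simp add: scaleR_conv_of_real)
  then have cq: "c = (\<integral>w. q w \<partial>N)"
    unfolding c_def of_real_eq_iff .
  note [measurable] = borel_measurable_integrable[OF p(1)] borel_measurable_integrable[OF q(1)] u v B
  show ?thesis
  proof (cases "c = 0")
    case True
    have "AE w in M. p w = 0"
      using integral_nonneg_eq_0_iff_AE[OF p(1)] p(2) True c_def by auto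
    moreover have "AE w in N. q w = 0"
      using integral_nonneg_eq_0_iff_AE[OF q(1)] q(2) True cq by auto
    ultimately show ?thesis
      by (subst (1 2) integral_eq_zero_AE) auto
  next
    case False
    have c: "0 < c"
      using False p(2) integral_nonneg_AE[of p M] unfolding c_def by fastforce
    define M' where "M' = distr (density M (\<lambda>w. p w / c)) borel u"
    define N' where "N' = distr (density N (\<lambda>w. q w / c)) borel v"
    have one: "prob_space (density L (\<lambda>w. ennreal (r w / c)))"
      if "integrable L r" "\<And>w. 0 \<le> r w" "c = (\<integral>w. r w \<partial>L)" for L :: "'c measure" and r
    proof
      note [measurable] = borel_measurable_integrable[OF that(1)]
      have "emeasure (density L (\<lambda>w. ennreal (r w / c))) (space L) = (\<integral>\<^sup>+w. ennreal (r w / c) \<partial>L)"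
        by (subst emeasure_density) (auto intro!: nn_integral_cong)
      also have "\<dots> = ennreal (\<integral>w. r w / c \<partial>L)"
        using that c by (intro nn_integral_eq_integral) auto
      also have "\<dots> = 1"
        using that c by simp
      finally show "emeasure (density L (\<lambda>w. ennreal (r w / c)))
          (space (density L (\<lambda>w. ennreal (r w / c)))) = 1" by simp
    qed
    have M': "real_distribution M'"
      unfolding M'_def using one[OF p c_def]
      by (intro prob_space.real_distribution_distr) auto
    have N': "real_distribution N'"
      unfolding N'_def using one[OF q cq]
      by (intro prob_space.real_distribution_distr) auto
    have cM: "char M' t = (1 / c) *\<^sub>R (CLINT w|M. p w *\<^sub>R iexp (t * u w))" for t
      unfolding M'_def char_def using p c
      by (simp add: integral_distr integral_density divide_inverse mult.commute
          flip: scaleR_scaleR)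
    have cN: "char N' t = (1 / c) *\<^sub>R (CLINT w|N. q w *\<^sub>R iexp (t * v w))" for t
      unfolding N'_def char_def using q c
      by (simp add: integral_distr integral_density divide_inverse mult.commute
          flip: scaleR_scaleR)
    have "M' = N'"
      using M' N' by (rule Levy_uniqueness) (simp_all only: fun_eq_iff cM cN char simp_thms)
    then have "(\<integral>x. indicat_real B x \<partial>M') = (\<integral>x. indicat_real B x \<partial>N')" by simp
    moreover have "(\<integral>x. indicat_real B x \<partial>M') = (\<integral>w. p w * indicat_real B (u w) \<partial>M) / c"
      unfolding M'_def using p c by (subst integral_distr) (auto simp: integral_density)
    moreover have "(\<integral>x. indicat_real B x \<partial>N') = (\<integral>w. q w * indicat_real B (v w) \<partial>N) / c"
      unfolding N'_def using q c by (subst integral_distr) (auto simp: integral_density)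
    ultimately show ?thesis using c by simp
  qed
qed

text \<open>
  The exponentials \<open>exp(i s\<^sub>j U\<^sub>j)\<close> are traded for indicators \<open>1(U\<^sub>j \<in> B\<^sub>j)\<close> one coordinate at a time. With the
  indicators traded so far and the exponentials still to be traded in the other coordinates absorbed
  into a weight, trading one more coordinate is a question about the law of a single variable.
\<close>

lemma mixed_char_indicator_eq:
  fixes U :: "'i \<Rightarrow> 'a \<Rightarrow> real" and V :: "'i \<Rightarrow> 'b \<Rightarrow> real"
  assumes "prob_space M" and "prob_space N" and I: "finite I"
    and U [measurable]: "\<And>i. i \<in> I \<Longrightarrow> U i \<in> borel_measurable M"
    and V [measurable]: "\<And>i. i \<in> I \<Longrightarrow> V i \<in> borel_measurable N"
    and char: "\<And>s. (CLINT w|M. iexp (\<Sum>i\<in>I. s i * U i w)) = (CLINT w|N. iexp (\<Sum>i\<in>I. s i * V i w))"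
    and "finite J" and "J \<subseteq> I" and "\<And>i. i \<in> J \<Longrightarrow> B i \<in> sets borel"
  shows "(CLINT w|M. (\<Prod>i\<in>J. indicat_real (B i) (U i w)) *\<^sub>R iexp (\<Sum>i\<in>I - J. s i * U i w)) =
         (CLINT w|N. (\<Prod>i\<in>J. indicat_real (B i) (V i w)) *\<^sub>R iexp (\<Sum>i\<in>I - J. s i * V i w))"
  using \<open>finite J\<close> \<open>J \<subseteq> I\<close> \<open>\<And>i. i \<in> J \<Longrightarrow> B i \<in> sets borel\<close>
proof (induction J arbitrary: s rule: finite_induct)
  case empty
  then show ?case using char by simp
next
  case (insert j J)
  interpret M: prob_space M by fact
  interpret N: prob_space N by fact
  have jI: "j \<in> I" "J \<subseteq> I" and Bj [measurable]: "B j \<in> sets borel"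
    and BJ [measurable]: "\<And>i. i \<in> J \<Longrightarrow> B i \<in> sets borel"
    using insert by auto
  define I' where "I' = I - insert j J"
  have I': "finite I'" "j \<notin> I'" "I - J = insert j I'" and I'I: "\<And>i. i \<in> I' \<Longrightarrow> i \<in> I"
    and JI: "\<And>i. i \<in> J \<Longrightarrow> i \<in> I"
    using insert I by (auto simp: I'_def)
  define P where "P y = (\<Prod>i\<in>J. indicat_real (B i) (y i))" for y :: "'i \<Rightarrow> real"
  define T where "T y = (\<Sum>i\<in>I'. s i * y i)" for y :: "'i \<Rightarrow> real"
  have P01: "0 \<le> P y" "P y \<le> 1" for y :: "'i \<Rightarrow> real"
    unfolding P_def by (auto intro!: prod_nonneg prod_le_1)
  have meas [measurable]: "(\<lambda>w. P (\<lambda>i. U i w)) \<in> borel_measurable M" "(\<lambda>w. P (\<lambda>i. V i w)) \<in> borel_measurable N"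
     "(\<lambda>w. T (\<lambda>i. U i w)) \<in> borel_measurable M" "(\<lambda>w. T (\<lambda>i. V i w)) \<in> borel_measurable N"
     "U j \<in> borel_measurable M" "V j \<in> borel_measurable N"
    unfolding P_def T_def using jI I'I JI by measurable
  define F where "F a t y = P y *\<^sub>R iexp (a * T y + t * y j)"
    for y :: "'i \<Rightarrow> real" and a t
  have IH: "(CLINT w|M. F a t (\<lambda>i. U i w)) = (CLINT w|N. F a t (\<lambda>i. V i w))" for a t
  proof -
    have *: "(\<Sum>i\<in>I - J. ((\<lambda>i. a * s i)(j := t)) i * y i) = a * T y + t * y j"
      for y :: "'i \<Rightarrow> real"
      using I' unfolding T_def I'(3)
      by (subst sum.insert) (auto simp: sum_distrib_left mult.assoc intro!: sum.cong)
    show ?thesis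
      using insert.IH[of "(\<lambda>i. a * s i)(j := t)"] jI BJ unfolding F_def P_def * by simp
  qed
  have intF: "integrable M (\<lambda>w. F a t (\<lambda>i. U i w))" "integrable N (\<lambda>w. F a t (\<lambda>i. V i w))" for a t
    unfolding F_def by (auto intro!: M.integrable_const_bound[where B=1]
        N.integrable_const_bound[where B=1] simp: P01 norm_mult)
  have cosF: "(P y * (1 + cos (T y))) *\<^sub>R iexp (t * y j) =
      F 0 t y + (1/2) *\<^sub>R F 1 t y + (1/2) *\<^sub>R F (-1) t y"
    for t and y :: "'i \<Rightarrow> real"
    unfolding F_def by (simp add: complex_eq_iff Re_exp Im_exp cos_add sin_add cos_diff sin_diff algebra_simps)
  have sinF: "(P y * (1 + sin (T y))) *\<^sub>R iexp (t * y j) =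
      F 0 t y - (\<i>/2) * F 1 t y + (\<i>/2) * F (-1) t y"
    for t and y :: "'i \<Rightarrow> real"
    unfolding F_def
    by (simp add: complex_eq_iff Re_exp Im_exp cos_add sin_add cos_diff sin_diff ring_distribs)
       (simp add: field_simps)
  have b1: "(\<integral>w. P (\<lambda>i. U i w) * indicat_real (B j) (U j w) \<partial>M) = (\<integral>w. P (\<lambda>i. V i w) * indicat_real (B j) (V j w) \<partial>N)"
    using IH[of 0]
    by (intro weighted_law_eqI) (auto simp: F_def P01 intro!: M.integrable_const_bound[where B=1]
        N.integrable_const_bound[where B=1])
  \<comment> \<open>The weight must be nonnegative, so its exponential enters through \<open>1 + cos T\<close> and \<open>1 + sin T\<close>.\<close>
  have le2: "P y * (1 + x) \<le> 2" "0 \<le> P y * (1 + x)" if "-1 \<le> x" "x \<le> 1"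
    for x and y :: "'i \<Rightarrow> real"
    using mult_mono[of "P y" 1 "1 + x" 2] P01[of y] that by auto
  have c2: "(CLINT w|M. (P (\<lambda>i. U i w) * (1 + cos (T (\<lambda>i. U i w)))) *\<^sub>R iexp (t * U j w)) =
      (CLINT w|N. (P (\<lambda>i. V i w) * (1 + cos (T (\<lambda>i. V i w)))) *\<^sub>R iexp (t * V j w))" for t
    unfolding cosF[of "\<lambda>i. U i w" for w] cosF[of "\<lambda>i. V i w" for w] using IH intF by simp
  have le3: "norm (P y * (1 + x) * indicat_real A z) \<le> 2" if "-1 \<le> x" "x \<le> 1"
    for x z and A :: "real set" and y :: "'i \<Rightarrow> real"
    using le2[OF that, of y] by (auto simp: indicator_def)
  have b2: "(\<integral>w. P (\<lambda>i. U i w) * (1 + cos (T (\<lambda>i. U i w))) * indicat_real (B j) (U j w) \<partial>M) =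
      (\<integral>w. P (\<lambda>i. V i w) * (1 + cos (T (\<lambda>i. V i w))) * indicat_real (B j) (V j w) \<partial>N)"
    by (rule weighted_law_eqI[OF _ _ _ _ _ _ c2])
       (auto simp: le2 intro!: M.integrable_const_bound[where B=2]
        N.integrable_const_bound[where B=2])
  have c3: "(CLINT w|M. (P (\<lambda>i. U i w) * (1 + sin (T (\<lambda>i. U i w)))) *\<^sub>R iexp (t * U j w)) =
      (CLINT w|N. (P (\<lambda>i. V i w) * (1 + sin (T (\<lambda>i. V i w)))) *\<^sub>R iexp (t * V j w))" for t
    unfolding sinF[of "\<lambda>i. U i w" for w] sinF[of "\<lambda>i. V i w" for w] using IH intF by simp
  have b3: "(\<integral>w. P (\<lambda>i. U i w) * (1 + sin (T (\<lambda>i. U i w))) * indicat_real (B j) (U j w) \<partial>M) =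
      (\<integral>w. P (\<lambda>i. V i w) * (1 + sin (T (\<lambda>i. V i w))) * indicat_real (B j) (V j w) \<partial>N)"
    by (rule weighted_law_eqI[OF _ _ _ _ _ _ c3])
       (auto simp: le2 intro!: M.integrable_const_bound[where B=2]
        N.integrable_const_bound[where B=2])
  have lin: "(CLINT w|L. of_real (a w) - of_real (b w) + \<i> * (of_real (c w) - of_real (b w))) =
      of_real (\<integral>w. a w \<partial>L) - of_real (\<integral>w. b w \<partial>L)
      + \<i> * (of_real (\<integral>w. c w \<partial>L) - of_real (\<integral>w. b w \<partial>L))"
    if "integrable L a" "integrable L b" "integrable L c" for L :: "'c measure" and a b c
    using that by simp
  have split: "(CLINT w|L. (\<Prod>i\<in>insert j J. indicat_real (B i) (W i w)) *\<^sub>R iexp (T (\<lambda>i. W i w))) =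
      of_real (\<integral>w. P (\<lambda>i. W i w) * (1 + cos (T (\<lambda>i. W i w))) * indicat_real (B j) (W j w) \<partial>L)
      - of_real (\<integral>w. P (\<lambda>i. W i w) * indicat_real (B j) (W j w) \<partial>L)
      + \<i> * (of_real (\<integral>w. P (\<lambda>i. W i w) * (1 + sin (T (\<lambda>i. W i w))) * indicat_real (B j) (W j w) \<partial>L)
      - of_real (\<integral>w. P (\<lambda>i. W i w) * indicat_real (B j) (W j w) \<partial>L))" (is "?l = ?r")
    if [measurable]: "(\<lambda>w. P (\<lambda>i. W i w)) \<in> borel_measurable L" "(\<lambda>w. T (\<lambda>i. W i w)) \<in> borel_measurable L"
       "W j \<in> borel_measurable L" and "prob_space L"
    for L :: "'c measure" and W
  proof -
    interpret L: prob_space L by fact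
    have i: "integrable L (\<lambda>w. P (\<lambda>i. W i w) * indicat_real (B j) (W j w))"
      by (intro L.integrable_const_bound[where B=1])
         (auto simp: P01 abs_mult indicator_def)
    have i2: "integrable L (\<lambda>w. P (\<lambda>i. W i w) * (1 + cos (T (\<lambda>i. W i w))) * indicat_real (B j) (W j w))"
      by (intro L.integrable_const_bound[where B=2])
         (simp_all add: le3 del: real_norm_def)
    have i3: "integrable L (\<lambda>w. P (\<lambda>i. W i w) * (1 + sin (T (\<lambda>i. W i w))) * indicat_real (B j) (W j w))"
      by (intro L.integrable_const_bound[where B=2])
         (simp_all add: le3 del: real_norm_def)
    have pr: "(\<Prod>i\<in>insert j J. indicat_real (B i) (W i w)) = indicat_real (B j) (W j w) * P (\<lambda>i. W i w)" for w
      using insert(1,2) by (simp add: P_def)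
    have "?l = (CLINT w|L. of_real (P (\<lambda>i. W i w) * (1 + cos (T (\<lambda>i. W i w))) * indicat_real (B j) (W j w))
      - of_real (P (\<lambda>i. W i w) * indicat_real (B j) (W j w))
      + \<i> * (of_real (P (\<lambda>i. W i w) * (1 + sin (T (\<lambda>i. W i w))) * indicat_real (B j) (W j w))
      - of_real (P (\<lambda>i. W i w) * indicat_real (B j) (W j w))))"
      unfolding pr
      by (intro Bochner_Integration.integral_cong refl)
        (simp add: complex_eq_iff Re_exp Im_exp algebra_simps)
    also have "\<dots> = ?r"
      by (rule lin[OF i2 i i3])
    finally show ?thesis .
  qed
  show ?case
    using split[OF meas(1) meas(3) meas(5) \<open>prob_space M\<close>] split[OF meas(2) meas(4) meas(6) \<open>prob_space N\<close>]
      b1 b2 b3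
    by (simp only: T_def I'_def)
qed

text \<open>
  The case of \<open>mixed_char_indicator_eq\<close> in which every exponential has been traded for an indicator.
\<close>

lemma joint_law_eqI:
  fixes U :: "'i \<Rightarrow> 'a \<Rightarrow> real" and V :: "'i \<Rightarrow> 'b \<Rightarrow> real"
  assumes "prob_space M" and "prob_space N" and I: "finite I"
    and U [measurable]: "\<And>i. i \<in> I \<Longrightarrow> U i \<in> borel_measurable M"
    and V [measurable]: "\<And>i. i \<in> I \<Longrightarrow> V i \<in> borel_measurable N"
    and char: "\<And>s. (CLINT w|M. iexp (\<Sum>i\<in>I. s i * U i w)) = (CLINT w|N. iexp (\<Sum>i\<in>I. s i * V i w))"
  shows "distr M (\<Pi>\<^sub>M i\<in>I. borel) (\<lambda>w. \<lambda>i\<in>I. U i w) = distr N (\<Pi>\<^sub>M i\<in>I. borel) (\<lambda>w. \<lambda>i\<in>I. V i w)"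
proof (rule measure_eqI_PiM_finite[OF I])
  interpret M: prob_space M by fact
  interpret N: prob_space N by fact
  show "sets (distr M (\<Pi>\<^sub>M i\<in>I. borel) (\<lambda>w. \<lambda>i\<in>I. U i w)) = sets (\<Pi>\<^sub>M i\<in>I. borel)"
       "sets (distr N (\<Pi>\<^sub>M i\<in>I. borel) (\<lambda>w. \<lambda>i\<in>I. V i w)) = sets (\<Pi>\<^sub>M i\<in>I. borel)"
    by simp_all
  fix A :: "'i \<Rightarrow> real set" assume A [measurable]: "\<And>i. i \<in> I \<Longrightarrow> A i \<in> sets borel"
  have em: "emeasure (distr L (\<Pi>\<^sub>M i\<in>I. borel) (\<lambda>w. \<lambda>i\<in>I. W i w)) (Pi\<^sub>E I A) =
     ennreal (Re (CLINT w|L. (\<Prod>i\<in>I. indicat_real (A i) (W i w)) *\<^sub>R iexp 0))"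
    if "prob_space L" and W [measurable]: "\<And>i. i \<in> I \<Longrightarrow> W i \<in> borel_measurable L" for L :: "'c measure" and W
  proof -
    interpret L: prob_space L by fact
    have PA: "Pi\<^sub>E I A \<in> sets (\<Pi>\<^sub>M i\<in>I. borel)" using I A by (auto intro!: sets_PiM_I_finite)
    have mW: "(\<lambda>w. \<lambda>i\<in>I. W i w) \<in> L \<rightarrow>\<^sub>M (\<Pi>\<^sub>M i\<in>I. borel)"
      using W by (auto intro!: measurable_restrict)
    have "emeasure (distr L (\<Pi>\<^sub>M i\<in>I. borel) (\<lambda>w. \<lambda>i\<in>I. W i w)) (Pi\<^sub>E I A) =
      emeasure L ((\<lambda>w. \<lambda>i\<in>I. W i w) -` Pi\<^sub>E I A \<inter> space L)"
      by (rule emeasure_distr[OF mW PA])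
    also have "\<dots> = ennreal (\<integral>w. indicat_real ((\<lambda>w. \<lambda>i\<in>I. W i w) -` Pi\<^sub>E I A \<inter> space L) w \<partial>L)"
      using measurable_sets[OF mW PA] by (simp add: L.emeasure_eq_measure)
    also have "(\<integral>w. indicat_real ((\<lambda>w. \<lambda>i\<in>I. W i w) -` Pi\<^sub>E I A \<inter> space L) w \<partial>L) =
      (\<integral>w. (\<Prod>i\<in>I. indicat_real (A i) (W i w)) \<partial>L)"
      using I by (intro Bochner_Integration.integral_cong refl)
        (auto simp: indicator_def PiE_iff prod_zero_iff)
    also have "\<dots> = Re (CLINT w|L. (\<Prod>i\<in>I. indicat_real (A i) (W i w)) *\<^sub>R iexp 0)"
      by (simp add: scaleR_conv_of_real flip: of_real_prod)
    finally show ?thesis .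
  qed
  show "emeasure (distr M (\<Pi>\<^sub>M i\<in>I. borel) (\<lambda>w. \<lambda>i\<in>I. U i w)) (Pi\<^sub>E I A) =
        emeasure (distr N (\<Pi>\<^sub>M i\<in>I. borel) (\<lambda>w. \<lambda>i\<in>I. V i w)) (Pi\<^sub>E I A)"
    using mixed_char_indicator_eq[OF \<open>prob_space M\<close> \<open>prob_space N\<close> I U V char I order_refl A, where s="\<lambda>_. 0"]
    by (simp add: em \<open>prob_space M\<close> \<open>prob_space N\<close>)
next
  show "range (\<lambda>_::nat. Pi\<^sub>E I (\<lambda>_. UNIV)) \<subseteq> prod_algebra I (\<lambda>_. borel :: real measure)"
    using I by (auto intro!: prod_algebraI_finite)
  show "(\<Union>i::nat. Pi\<^sub>E I (\<lambda>_. UNIV)) = space (\<Pi>\<^sub>M i\<in>I. borel :: real measure)"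
    by (simp add: space_PiM)
  interpret M: prob_space M by fact
  have mU: "(\<lambda>w. \<lambda>i\<in>I. U i w) \<in> M \<rightarrow>\<^sub>M (\<Pi>\<^sub>M i\<in>I. borel)"
    using U by (auto intro!: measurable_restrict)
  show "emeasure (distr M (\<Pi>\<^sub>M i\<in>I. borel) (\<lambda>w. \<lambda>i\<in>I. U i w)) (Pi\<^sub>E I (\<lambda>_. UNIV)) \<noteq> \<infinity>" for i :: nat
    using prob_space.emeasure_le_1[OF M.prob_space_distr[OF mU], of "Pi\<^sub>E I (\<lambda>_. UNIV)"]
    by (auto simp: top_unique)
qed

section \<open>Gaussian variables\<close>

lemma gaussian_variable_cong:
  assumes "gaussian_variable M Y" and "\<And>w. w \<in> space M \<Longrightarrow> Y w = Z w"
  shows "gaussian_variable M Z"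
proof -
  have "distributed M lborel Y g \<Longrightarrow> distributed M lborel Z g" for g
    using assms(2) distr_cong[of M M lborel lborel Y Z] measurable_cong[of M Y Z lborel]
    by (simp add: distributed_def)
  moreover have "AE w in M. Y w = \<mu> \<Longrightarrow> AE w in M. Z w = \<mu>" for \<mu>
    using assms(2) AE_space by (auto elim!: eventually_elim2)
  ultimately show ?thesis
    using assms(1) unfolding gaussian_variable_def by blast
qed

lemma gaussian_variable_square_integrable:
  assumes "prob_space M" and "Y \<in> borel_measurable M" and "gaussian_variable M Y"
  shows "integrable M Y" "integrable M (\<lambda>w. (Y w)\<^sup>2)"
proof -
  interpret prob_space M by fact
  note [measurable] = assms(2)
  have "integrable M Y \<and> integrable M (\<lambda>w. (Y w)\<^sup>2)"
    using assms(3) unfolding gaussian_variable_def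
  proof (elim disjE exE conjE)
    fix \<mu> \<sigma> :: real
    assume "0 < \<sigma>" and D: "distributed M lborel Y (\<lambda>y. ennreal (normal_density \<mu> \<sigma> y))"
    have 1: "integrable M (\<lambda>w. Y w - \<mu>)"
      using integrable_normal_moment[OF \<open>0 < \<sigma>\<close>, of \<mu> 1] \<open>0 < \<sigma>\<close>
      by (subst distributed_integrable[OF D, symmetric]) auto
    have 2: "integrable M (\<lambda>w. (Y w - \<mu>)\<^sup>2)"
      using integrable_normal_moment[OF \<open>0 < \<sigma>\<close>, of \<mu> 2] \<open>0 < \<sigma>\<close>
      by (subst distributed_integrable[OF D, symmetric]) auto
    have "integrable M (\<lambda>w. (Y w - \<mu>) + \<mu>)" using 1 by (intro Bochner_Integration.integrable_add) auto
    moreover have "integrable M (\<lambda>w. (Y w - \<mu>)\<^sup>2 + 2 * \<mu> * (Y w - \<mu>) + \<mu>\<^sup>2)"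
      using 1 2 by (intro Bochner_Integration.integrable_add integrable_mult_right) auto
    moreover have "(\<lambda>w. (Y w - \<mu>)\<^sup>2 + 2 * \<mu> * (Y w - \<mu>) + \<mu>\<^sup>2) = (\<lambda>w. (Y w)\<^sup>2)"
      by (auto simp: power2_eq_square algebra_simps)
    ultimately show ?thesis by simp
  next
    fix \<mu> assume *: "AE w in M. Y w = \<mu>"
    have "integrable M Y \<longleftrightarrow> integrable M (\<lambda>_. \<mu>)"
      using * by (intro integrable_cong_AE) auto
    moreover have "integrable M (\<lambda>w. (Y w)\<^sup>2) \<longleftrightarrow> integrable M (\<lambda>_. \<mu>\<^sup>2)"
      using * by (intro integrable_cong_AE) auto
    ultimately show ?thesis by simp
  qed
  then show "integrable M Y" "integrable M (\<lambda>w. (Y w)\<^sup>2)" by auto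
qed

lemma char_gaussian_variable:
  assumes "prob_space M" and "Y \<in> borel_measurable M" and "gaussian_variable M Y"
    and mean: "(\<integral>w. Y w \<partial>M) = 0"
  shows "(CLINT w|M. iexp (Y w)) = of_real (exp (- (\<integral>w. (Y w)\<^sup>2 \<partial>M) / 2))"
proof -
  interpret prob_space M by fact
  note [measurable] = assms(2)
  from assms(3) show ?thesis unfolding gaussian_variable_def
  proof (elim disjE exE conjE)
    fix \<mu> \<sigma> :: real
    assume \<sigma>: "0 < \<sigma>" and D: "distributed M lborel Y (\<lambda>y. ennreal (normal_density \<mu> \<sigma> y))"
    have mu: "\<mu> = 0" using normal_distributed_expectation[OF \<sigma> D] mean by simp
    have var: "(\<integral>w. (Y w)\<^sup>2 \<partial>M) = \<sigma>\<^sup>2"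
      using normal_distributed_variance[OF \<sigma> D] mean by simp
    have D1: "distributed M lborel (\<lambda>w. Y w / \<sigma>) std_normal_density"
      using D normal_standard_normal_convert[OF \<sigma>, of Y \<mu>] mu by simp
    have "char std_normal_distribution \<sigma> = (CLINT x|distr M lborel (\<lambda>w. Y w / \<sigma>). iexp (\<sigma> * x))"
      unfolding char_def using D1 by (simp add: distributed_def)
    also have "\<dots> = (CLINT w|M. iexp (\<sigma> * (Y w / \<sigma>)))"
      by (rule integral_distr) auto
    also have "\<dots> = (CLINT w|M. iexp (Y w))"
      using \<sigma> by simp
    finally show ?thesis
      by (simp add: char_std_normal_distribution var)
  next
    fix \<mu> assume *: "AE w in M. Y w = \<mu>"
    have "(\<integral>w. Y w \<partial>M) = (\<integral>w. \<mu> \<partial>M)"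
      using * by (intro integral_cong_AE) auto
    then have "\<mu> = 0" using mean by (simp add: prob_space)
    have "(CLINT w|M. iexp (Y w)) = (CLINT w|M. 1)"
      using * \<open>\<mu> = 0\<close> by (intro integral_cong_AE) auto
    moreover have "(\<integral>w. (Y w)\<^sup>2 \<partial>M) = (\<integral>w. 0 \<partial>M)"
      using * \<open>\<mu> = 0\<close> by (intro integral_cong_AE) auto
    ultimately show ?thesis by (simp add: prob_space)
  qed
qed

text \<open>
  Centring a field needs this, because its mean may be nonzero.
\<close>

lemma gaussian_variable_shift:
  assumes "prob_space M" and "gaussian_variable M Y"
  shows "gaussian_variable M (\<lambda>w. Y w - c)"
proof -
  interpret prob_space M by fact
  from assms(2) show ?thesis unfolding gaussian_variable_def [of M Y]
  proof (elim disjE exE conjE)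
    fix \<mu> \<sigma> :: real
    assume \<sigma>: "0 < \<sigma>" and D: "distributed M lborel Y (\<lambda>y. ennreal (normal_density \<mu> \<sigma> y))"
    have "distributed M lborel (\<lambda>w. - c + 1 * Y w) (\<lambda>y. ennreal (normal_density (- c + 1 * \<mu>) (\<bar>1\<bar> * \<sigma>) y))"
      by (rule normal_density_affine[OF D \<sigma>]) simp
    then show ?thesis
      unfolding gaussian_variable_def
      using \<sigma> by (intro disjI1 exI[of _ "\<mu> - c"] exI[of _ \<sigma>]) simp
  next
    fix \<mu> assume "AE w in M. Y w = \<mu>"
    then show ?thesis
      unfolding gaussian_variable_def by (intro disjI2 exI[of _ "\<mu> - c"]) auto
  qed
qed

section \<open>Smooth functions of finitely many coordinates\<close>

lemma smooth_function_cong: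
  assumes "smooth_function m f" and "\<And>i. i < m \<Longrightarrow> x i = y i"
  shows "f x = f y"
  using assms unfolding smooth_function_def by blast

lemma coord_deriv_cong:
  assumes "smooth_function m f" and "\<And>i. i < m \<Longrightarrow> x i = y i" and "j < m"
  shows "coord_deriv j f x = coord_deriv j f y"
proof -
  have "f (x(j := t)) = f (y(j := t))" for t
    using assms(2) by (intro smooth_function_cong[OF assms(1)]) auto
  then show ?thesis unfolding coord_deriv_def using assms by simp
qed

lemma smooth_function_continuous:
  assumes "smooth_function m f"
  shows "continuous_on UNIV f"
proof -
  have "\<forall>is\<in>lists {..<m}. continuous_on UNIV (foldr coord_deriv is f)"
    using assms unfolding smooth_function_def by blast
  then show ?thesis by (drule_tac bspec[where x="[]"]) auto
qed

lemma smooth_function_continuous_deriv: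
  assumes "smooth_function m f" and "j < m"
  shows "continuous_on UNIV (coord_deriv j f)"
proof -
  have "\<forall>is\<in>lists {..<m}. continuous_on UNIV (foldr coord_deriv is f)"
    using assms unfolding smooth_function_def by blast
  then show ?thesis using assms(2) by (drule_tac bspec[where x="[j]"]) auto
qed

lemma smooth_function_has_coord_deriv:
  assumes "smooth_function m f" and "j < m"
  shows "((\<lambda>t. f (x(j := t))) has_real_derivative coord_deriv j f (x(j := a))) (at a)"
proof -
  have "\<forall>is\<in>lists {..<m}. \<forall>i<m. \<forall>x. (\<lambda>t. foldr coord_deriv is f (x(i := t))) differentiable (at (x i))"
    using assms unfolding smooth_function_def by blast
  from bspec[OF this, of "[]"] have "\<forall>i<m. \<forall>x. (\<lambda>t. f (x(i := t))) differentiable (at (x i))"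
    by simp
  from this[rule_format, OF assms(2), of "x(j := a)"]
  have "(\<lambda>t. f (x(j := t))) differentiable (at a)"
    by simp
  then show ?thesis
    by (simp add: DERIV_deriv_iff_real_differentiable coord_deriv_def)
qed

lemma tendsto_fun_iff:
  fixes f :: "'a \<Rightarrow> 'i \<Rightarrow> 'b::topological_space"
  shows "(f \<longlongrightarrow> l) F \<longleftrightarrow> (\<forall>i. ((\<lambda>c. f c i) \<longlongrightarrow> l i) F)"
  using limitin_componentwise[of "\<lambda>_. euclidean :: 'b topology" UNIV f l F]
  by (simp add: euclidean_product_topology)

text \<open>
  The coordinate derivatives are assumed to exist only along the axes. The increment of \<open>f\<close> along the
  path is therefore split into increments that move one coordinate at a time; the mean value theorem
  applies to each, and continuity of the coordinate derivatives moves the intermediate points to \<open>x t\<close>.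
\<close>

lemma smooth_function_chain_rule:
  assumes f: "smooth_function m f"
    and x: "\<And>i. ((\<lambda>t. x t i) has_real_derivative x' i) (at t)"
  shows "((\<lambda>t. f (x t)) has_real_derivative (\<Sum>i<m. coord_deriv i f (x t) * x' i)) (at t)"
proof -
  \<comment> \<open>The point whose first \<open>k\<close> coordinates have already been moved from time \<open>t\<close> to time \<open>t + h\<close>.\<close>
  define z where "z k h i = (if i < k then x (t + h) i else x t i)" for k h i
  have z_Suc: "z (Suc k) h = (z k h)(k := x (t + h) k)" "z k h = (z k h)(k := x t k)" for k h
    by (auto simp: z_def fun_eq_iff less_Suc_eq)
  have "\<exists>\<xi>. \<bar>\<xi> - x t k\<bar> \<le> \<bar>x (t + h) k - x t k\<bar> \<and>
       f (z (Suc k) h) - f (z k h) = coord_deriv k f ((z k h)(k := \<xi>)) * (x (t + h) k - x t k)"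
    if "k < m" for k h
  proof -
    let ?g = "\<lambda>s. f ((z k h)(k := s))" and ?d = "\<lambda>s. coord_deriv k f ((z k h)(k := s))"
    have d: "(?g has_real_derivative ?d s) (at s)" for s
      by (rule smooth_function_has_coord_deriv[OF f that])
    have "\<exists>\<xi>. \<bar>\<xi> - x t k\<bar> \<le> \<bar>x (t + h) k - x t k\<bar> \<and>
       ?g (x (t + h) k) - ?g (x t k) = ?d \<xi> * (x (t + h) k - x t k)"
    proof (rule linorder_cases[of "x t k" "x (t + h) k"])
      assume "x t k < x (t + h) k"
      from MVT2[OF this d] obtain \<xi> where "x t k < \<xi>" "\<xi> < x (t + h) k"
        "?g (x (t + h) k) - ?g (x t k) = (x (t + h) k - x t k) * ?d \<xi>" by auto
      then show ?thesis by (intro exI[of _ \<xi>]) (auto simp: mult.commute)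
    next
      assume "x (t + h) k < x t k"
      from MVT2[OF this d] obtain \<xi> where *: "\<xi> < x t k" "x (t + h) k < \<xi>"
        "?g (x t k) - ?g (x (t + h) k) = (x t k - x (t + h) k) * ?d \<xi>" by auto
      then have "?g (x (t + h) k) - ?g (x t k) = ?d \<xi> * (x (t + h) k - x t k)"
        by (simp add: algebra_simps)
      with * show ?thesis by (intro exI[of _ \<xi>]) auto
    qed auto
    then show ?thesis using z_Suc[of k h] by metis
  qed
  then obtain \<xi> where \<xi>: "\<And>k h. k < m \<Longrightarrow> \<bar>\<xi> k h - x t k\<bar> \<le> \<bar>x (t + h) k - x t k\<bar>"
    "\<And>k h. k < m \<Longrightarrow>
       f (z (Suc k) h) - f (z k h) = coord_deriv k f ((z k h)(k := \<xi> k h)) * (x (t + h) k - x t k)"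
    by metis
  have xt: "((\<lambda>h. x (t + h) i) \<longlongrightarrow> x t i) (at 0)" for i
    using DERIV_isCont[OF x[of i]] by (simp add: isCont_iff)
  have lim: "((\<lambda>h. coord_deriv k f ((z k h)(k := \<xi> k h))) \<longlongrightarrow> coord_deriv k f (x t)) (at 0)"
    if k: "k < m" for k
  proof -
    have "((\<lambda>h. (z k h)(k := \<xi> k h)) \<longlongrightarrow> x t) (at 0)"
    proof (intro tendsto_fun_iff[THEN iffD2] allI)
      fix i
      show "((\<lambda>h. ((z k h)(k := \<xi> k h)) i) \<longlongrightarrow> x t i) (at 0)"
      proof (cases "i = k")
        case True
        have "((\<lambda>h. \<xi> k h - x t k) \<longlongrightarrow> 0) (at 0)"
        proof (rule Lim_null_comparison)
          show "\<forall>\<^sub>F h in at 0. norm (\<xi> k h - x t k) \<le> \<bar>x (t + h) k - x t k\<bar>"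
            using \<xi>(1)[OF k] by simp
          show "((\<lambda>h. \<bar>x (t + h) k - x t k\<bar>) \<longlongrightarrow> 0) (at 0)"
            using xt[of k] by (simp add: LIM_zero_iff tendsto_rabs_zero_iff)
        qed
        then show ?thesis using True by (simp add: LIM_zero_iff)
      next
        case False
        then show ?thesis using xt[of i] by (cases "i < k") (simp_all add: z_def)
      qed
    qed
    moreover have "isCont (coord_deriv k f) (x t)"
      using smooth_function_continuous_deriv[OF f k] by (simp add: continuous_on_eq_continuous_at)
    ultimately show ?thesis by (rule isCont_tendsto_compose[rotated])
  qed
  have "f (x (t + h)) - f (x t) = (\<Sum>k<m. f (z (Suc k) h) - f (z k h))" for h
  proof -
    have "f (z m h) = f (x (t + h))" using f by (rule smooth_function_cong) (simp add: z_def)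
    moreover have "z 0 h = x t" by (simp add: z_def fun_eq_iff)
    ultimately show ?thesis using sum_lessThan_telescope[of "\<lambda>k. f (z k h)" m] by simp
  qed
  then have q: "(f (x (t + h)) - f (x t)) / h = (\<Sum>k<m. coord_deriv k f ((z k h)(k := \<xi> k h)) *
      ((x (t + h) k - x t k) / h))" for h
    unfolding times_divide_eq_right sum_divide_distrib[symmetric]
    by (intro arg_cong[where f="\<lambda>s. s / h"]) (auto intro!: sum.cong simp: \<xi>(2))
  have "((\<lambda>h. \<Sum>k<m. coord_deriv k f ((z k h)(k := \<xi> k h)) * ((x (t + h) k - x t k) / h))
      \<longlongrightarrow> (\<Sum>k<m. coord_deriv k f (x t) * x' k)) (at 0)"
    using x by (intro tendsto_sum tendsto_mult lim) (auto simp: DERIV_def)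
  then show ?thesis unfolding DERIV_def q .
qed

section \<open>The Gaussian Poincare inequality\<close>

text \<open>
  The Cauchy-Schwarz inequality for \<open>f b - f a = \<integral> f'\<close>, from nonnegativity of the variance of \<open>f'\<close> about
  its average \<open>c\<close> over the interval.
\<close>

lemma ennreal_sq_diff_le_nn_integral:
  fixes f f' :: "real \<Rightarrow> real"
  assumes "a < b"
    and f: "\<And>x. a \<le> x \<Longrightarrow> x \<le> b \<Longrightarrow> (f has_real_derivative f' x) (at x)"
    and f': "continuous_on {a..b} f'"
  shows "ennreal ((f b - f a)\<^sup>2) \<le> (\<integral>\<^sup>+x. ennreal ((b - a) * (f' x)\<^sup>2) * indicator {a..b} x \<partial>lborel)"
proof -
  define h where "h = f b - f a"
  have i1: "set_integrable lborel {a..b} f'" "set_integrable lborel {a..b} (\<lambda>x. (f' x)\<^sup>2)"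
     "set_integrable lborel {a..b} (\<lambda>x. c\<^sup>2)" for c :: real
    using f' by (auto intro!: borel_integrable_atLeastAtMost' continuous_intros)
  have I1: "(LINT x:{a..b}|lborel. f' x) = h"
    unfolding h_def set_lebesgue_integral_def using assms
    by (intro integral_FTC_atLeastAtMost)
      (auto intro: has_field_derivative_at_within simp flip: has_real_derivative_iff_has_vector_derivative)
  have I0: "(LINT x:{a..b}|lborel. c\<^sup>2) = c\<^sup>2 * (b - a)" for c :: real
    using \<open>a < b\<close> by (simp add: set_lebesgue_integral_def)
  define c where "c = h / (b - a)"
  have "0 \<le> (LINT x:{a..b}|lborel. (f' x - c)\<^sup>2)"
    unfolding set_lebesgue_integral_def by (intro Bochner_Integration.integral_nonneg) auto
  also have "(LINT x:{a..b}|lborel. (f' x - c)\<^sup>2) =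
      (LINT x:{a..b}|lborel. (f' x)\<^sup>2 - 2 * c * f' x + c\<^sup>2)"
    by (intro set_lebesgue_integral_cong) (auto simp: power2_eq_square algebra_simps)
  also have "\<dots> = (LINT x:{a..b}|lborel. (f' x)\<^sup>2) - 2 * c * h + c\<^sup>2 * (b - a)"
    using i1 by (subst set_integral_add set_integral_diff set_integral_mult_right;
      auto simp: I1 I0 intro!: set_integral_diff set_integrable_mult_right)+
  finally have nonneg: "0 \<le> (LINT x:{a..b}|lborel. (f' x)\<^sup>2) - 2 * c * h + c\<^sup>2 * (b - a)" .
  have ch: "c * (b - a) = h"
    using \<open>a < b\<close> by (simp add: c_def)
  have "(b - a) * (I - 2 * c * h + c\<^sup>2 * (b - a)) = (b - a) * I - h\<^sup>2" for I
    unfolding ch[symmetric] by (simp add: power2_eq_square algebra_simps)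
  with mult_nonneg_nonneg[OF _ nonneg, of "b - a"] \<open>a < b\<close>
  have "h\<^sup>2 \<le> (b - a) * (LINT x:{a..b}|lborel. (f' x)\<^sup>2)"
    by simp
  also have "\<dots> = (\<integral>x. (b - a) * (indicator {a..b} x *\<^sub>R (f' x)\<^sup>2) \<partial>lborel)"
    by (simp add: set_lebesgue_integral_def)
  finally have "ennreal (h\<^sup>2) \<le> ennreal (\<integral>x. (b - a) * (indicator {a..b} x *\<^sub>R (f' x)\<^sup>2) \<partial>lborel)"
    by (rule ennreal_leI)
  also have "\<dots> = (\<integral>\<^sup>+x. ennreal ((b - a) * (indicator {a..b} x *\<^sub>R (f' x)\<^sup>2)) \<partial>lborel)"
    using i1(2) \<open>a < b\<close> unfolding set_integrable_def
    by (intro nn_integral_eq_integral[symmetric] integrable_mult_right) auto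
  also have "\<dots> = (\<integral>\<^sup>+x. ennreal ((b - a) * (f' x)\<^sup>2) * indicator {a..b} x \<partial>lborel)"
    by (intro nn_integral_cong) (auto simp: indicator_def)
  finally show ?thesis unfolding h_def .
qed

text \<open>
  A rotation of the pair \<open>(Y, Y')\<close> turns a linear functional with coefficients \<open>(a, b)\<close> into the one with
  the rotated coefficients. Its variance is unchanged, since
  \<open>(cos \<theta> A - sin \<theta> B)\<^sup>2 + (sin \<theta> A + cos \<theta> B)\<^sup>2 = A\<^sup>2 + B\<^sup>2\<close> pointwise, and the variance determines the
  characteristic function. The vanishing of \<open>Y i\<close> for \<open>i \<ge> m\<close> makes \<open>G\<close>, a function of infinite
  sequences, depend on the \<open>2m\<close> relevant coordinates only.
\<close>

lemma gaussian_rotation_invariance: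
  fixes Y :: "nat \<Rightarrow> 'w \<Rightarrow> real"
  assumes M: "prob_space M"
    and Y [measurable]: "\<And>i. Y i \<in> borel_measurable M"
    and gauss: "\<And>a. gaussian_variable M (\<lambda>w. \<Sum>i<m. a i * Y i w)"
    and centred: "\<And>a. (\<integral>w. (\<Sum>i<m. a i * Y i w) \<partial>M) = 0"
    and Y0: "\<And>i w. m \<le> i \<Longrightarrow> Y i w = 0"
    and G [measurable]: "G \<in> borel_measurable (borel \<Otimes>\<^sub>M borel)"
  shows "(\<integral>\<^sup>+z. G (\<lambda>i. cos \<theta> * Y i (fst z) + sin \<theta> * Y i (snd z),
                    \<lambda>i. - sin \<theta> * Y i (fst z) + cos \<theta> * Y i (snd z)) \<partial>(M \<Otimes>\<^sub>M M)) =
         (\<integral>\<^sup>+z. G (\<lambda>i. Y i (fst z), \<lambda>i. Y i (snd z)) \<partial>(M \<Otimes>\<^sub>M M))"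
proof -
  interpret M: prob_space M by fact
  interpret P: pair_prob_space M M ..
  define L where "L a w = (\<Sum>i<m. a i * Y i w)" for a w
  have [measurable]: "L a \<in> borel_measurable M" for a unfolding L_def by measurable
  have L_sq: "integrable M (\<lambda>w. (L a w)\<^sup>2)" for a
    using gauss[of a] by (intro gaussian_variable_square_integrable M) (simp_all add: L_def[abs_def])
  have L_char: "(CLINT w|M. iexp (L a w)) = of_real (exp (- (\<integral>w. (L a w)\<^sup>2 \<partial>M) / 2))" for a
    using gauss[of a] centred[of a] by (intro char_gaussian_variable M) (simp_all add: L_def[abs_def])
  have pair_char: "(CLINT z|M \<Otimes>\<^sub>M M. iexp (L a (fst z) + L b (snd z))) =
      of_real (exp (- ((\<integral>w. (L a w)\<^sup>2 \<partial>M) + (\<integral>w. (L b w)\<^sup>2 \<partial>M)) / 2))" for a b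
  proof -
    have "(CLINT z|M \<Otimes>\<^sub>M M. iexp (L a (fst z) + L b (snd z))) =
        (CLINT x|M. CLINT y|M. iexp (L a x + L b y))"
      by (subst P.integral_fst'[symmetric])
         (auto intro!: P.P.integrable_const_bound[where B=1])
    also have "\<dots> = (CLINT x|M. CLINT y|M. iexp (L a x) * iexp (L b y))"
      by (simp add: exp_add distrib_left)
    also have "\<dots> = (CLINT x|M. iexp (L a x)) * (CLINT y|M. iexp (L b y))"
      by simp
    also have "\<dots> = of_real (exp (- ((\<integral>w. (L a w)\<^sup>2 \<partial>M) + (\<integral>w. (L b w)\<^sup>2 \<partial>M)) / 2))"
      unfolding L_char by (simp add: exp_add[symmetric] add_divide_distrib diff_divide_distrib
          flip: of_real_mult of_real_add)
    finally show ?thesis .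
  qed
  define I where "I = (UNIV :: bool set) \<times> {..<m}"
  have "finite I" by (simp add: I_def)
  have sum_I: "(\<Sum>p\<in>I. g p) = (\<Sum>i<m. g (False, i)) + (\<Sum>i<m. g (True, i))" for g :: "bool \<times> nat \<Rightarrow> real"
    unfolding I_def by (simp add: sum.cartesian_product[symmetric, of "\<lambda>b i. g (b, i)", simplified] UNIV_bool)
  define U where "U p z = (if fst p then Y (snd p) (snd z) else Y (snd p) (fst z))" for p :: "bool \<times> nat" and z
  define V where "V p z = (if fst p then - sin \<theta> * Y (snd p) (fst z) + cos \<theta> * Y (snd p) (snd z)
      else cos \<theta> * Y (snd p) (fst z) + sin \<theta> * Y (snd p) (snd z))" for p :: "bool \<times> nat" and z
  have U [measurable]: "U p \<in> borel_measurable (M \<Otimes>\<^sub>M M)" for p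
    by (cases "fst p") (simp_all add: U_def[abs_def])
  have V [measurable]: "V p \<in> borel_measurable (M \<Otimes>\<^sub>M M)" for p
    by (cases "fst p") (simp_all add: V_def[abs_def])
  have law: "distr (M \<Otimes>\<^sub>M M) (\<Pi>\<^sub>M i\<in>I. borel) (\<lambda>z. \<lambda>p\<in>I. V p z) =
             distr (M \<Otimes>\<^sub>M M) (\<Pi>\<^sub>M i\<in>I. borel) (\<lambda>z. \<lambda>p\<in>I. U p z)"
  proof (intro joint_law_eqI P.prob_space_axioms \<open>finite I\<close> U V)
    fix s :: "bool \<times> nat \<Rightarrow> real"
    define a where "a i = s (False, i)" for i
    define b where "b i = s (True, i)" for i
    have Us: "(\<Sum>p\<in>I. s p * U p z) = L a (fst z) + L b (snd z)" for z
      by (simp add: sum_I U_def L_def a_def b_def)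
    have lin: "L (\<lambda>i. \<alpha> * a i + \<beta> * b i) w = \<alpha> * L a w + \<beta> * L b w" for \<alpha> \<beta> w
      by (simp add: L_def sum_distrib_left distrib_right sum.distrib mult.assoc)
    have Vs: "(\<Sum>p\<in>I. s p * V p z) =
        L (\<lambda>i. cos \<theta> * a i + (- sin \<theta>) * b i) (fst z) + L (\<lambda>i. sin \<theta> * a i + cos \<theta> * b i) (snd z)" for z
      unfolding lin
      by (simp add: sum_I V_def L_def a_def b_def sum_distrib_left sum.distrib sum_subtractf sum_negf algebra_simps)
    have "(\<integral>w. (L (\<lambda>i. cos \<theta> * a i + (- sin \<theta>) * b i) w)\<^sup>2 \<partial>M)
         + (\<integral>w. (L (\<lambda>i. sin \<theta> * a i + cos \<theta> * b i) w)\<^sup>2 \<partial>M)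
         = (\<integral>w. (L (\<lambda>i. cos \<theta> * a i + (- sin \<theta>) * b i) w)\<^sup>2 + (L (\<lambda>i. sin \<theta> * a i + cos \<theta> * b i) w)\<^sup>2 \<partial>M)"
      by (intro Bochner_Integration.integral_add[symmetric] L_sq)
    also have "\<dots> = (\<integral>w. (L a w)\<^sup>2 + (L b w)\<^sup>2 \<partial>M)"
    proof (intro Bochner_Integration.integral_cong refl)
      fix w
      have "(cos \<theta> * A + (- sin \<theta>) * B)\<^sup>2 + (sin \<theta> * A + cos \<theta> * B)\<^sup>2 =
          ((sin \<theta>)\<^sup>2 + (cos \<theta>)\<^sup>2) * (A\<^sup>2 + B\<^sup>2)" for A B :: real
        by algebra
      then show "(L (\<lambda>i. cos \<theta> * a i + (- sin \<theta>) * b i) w)\<^sup>2 + (L (\<lambda>i. sin \<theta> * a i + cos \<theta> * b i) w)\<^sup>2 =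
          (L a w)\<^sup>2 + (L b w)\<^sup>2"
        unfolding lin by simp
    qed
    also have "\<dots> = (\<integral>w. (L a w)\<^sup>2 \<partial>M) + (\<integral>w. (L b w)\<^sup>2 \<partial>M)"
      by (intro Bochner_Integration.integral_add L_sq)
    finally show "(CLINT z|M \<Otimes>\<^sub>M M. iexp (\<Sum>p\<in>I. s p * V p z)) = (CLINT z|M \<Otimes>\<^sub>M M. iexp (\<Sum>p\<in>I. s p * U p z))"
      unfolding Us Vs pair_char by simp
  qed
  define \<Phi> where "\<Phi> u = (\<lambda>i. if i < m then u (False, i) else 0 :: real, \<lambda>i. if i < m then u (True, i) else 0 :: real)"
    for u :: "bool \<times> nat \<Rightarrow> real"
  have comp: "(\<lambda>u. if i < m then u (b, i) else 0) \<in> borel_measurable (\<Pi>\<^sub>M i\<in>I. borel)" for b i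
  proof (cases "i < m")
    case True
    then have "(b, i) \<in> I" by (simp add: I_def)
    then show ?thesis using True by simp
  qed simp
  have [measurable]: "\<Phi> \<in> (\<Pi>\<^sub>M i\<in>I. borel) \<rightarrow>\<^sub>M borel \<Otimes>\<^sub>M borel"
    unfolding \<Phi>_def
    by (intro measurable_Pair measurable_coordinatewise_then_product comp)
  have [measurable]: "(\<lambda>z. \<lambda>p\<in>I. U p z) \<in> M \<Otimes>\<^sub>M M \<rightarrow>\<^sub>M (\<Pi>\<^sub>M i\<in>I. borel)"
     "(\<lambda>z. \<lambda>p\<in>I. V p z) \<in> M \<Otimes>\<^sub>M M \<rightarrow>\<^sub>M (\<Pi>\<^sub>M i\<in>I. borel)"
    by (auto intro!: measurable_restrict)
  have \<Phi>U: "\<Phi> (\<lambda>p\<in>I. U p z) = (\<lambda>i. Y i (fst z), \<lambda>i. Y i (snd z))" for z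
    using Y0 by (auto simp: \<Phi>_def U_def I_def fun_eq_iff)
  have \<Phi>V: "\<Phi> (\<lambda>p\<in>I. V p z) = (\<lambda>i. cos \<theta> * Y i (fst z) + sin \<theta> * Y i (snd z),
                    \<lambda>i. - sin \<theta> * Y i (fst z) + cos \<theta> * Y i (snd z))" for z
    using Y0 by (auto simp: \<Phi>_def V_def I_def fun_eq_iff)
  have "(\<integral>\<^sup>+u. G (\<Phi> u) \<partial>distr (M \<Otimes>\<^sub>M M) (\<Pi>\<^sub>M i\<in>I. borel) (\<lambda>z. \<lambda>p\<in>I. V p z)) =
        (\<integral>\<^sup>+u. G (\<Phi> u) \<partial>distr (M \<Otimes>\<^sub>M M) (\<Pi>\<^sub>M i\<in>I. borel) (\<lambda>z. \<lambda>p\<in>I. U p z))"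
    unfolding law ..
  then show ?thesis
    by (simp add: nn_integral_distr \<Phi>U \<Phi>V)
qed

text \<open>
  The increment of \<open>f\<close> along the quarter circle from \<open>Y\<close> to its copy \<open>Y'\<close> is estimated by the
  Cauchy-Schwarz inequality; by rotation invariance every angle then contributes the same
  expectation. One factor \<open>\<pi>/2\<close> comes from each of these two steps.
\<close>

lemma gaussian_poincare_two_copies:
  fixes Y :: "nat \<Rightarrow> 'w \<Rightarrow> real"
  assumes M: "prob_space M"
    and Y [measurable]: "\<And>i. Y i \<in> borel_measurable M"
    and gauss: "\<And>a. gaussian_variable M (\<lambda>w. \<Sum>i<m. a i * Y i w)"
    and centred: "\<And>a. (\<integral>w. (\<Sum>i<m. a i * Y i w) \<partial>M) = 0"
    and Y0: "\<And>i w. m \<le> i \<Longrightarrow> Y i w = 0"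
    and f: "smooth_function m f"
  shows "(\<integral>\<^sup>+z. ennreal ((f (\<lambda>i. \<mu> i + Y i (snd z)) - f (\<lambda>i. \<mu> i + Y i (fst z)))\<^sup>2) \<partial>(M \<Otimes>\<^sub>M M)) \<le>
    ennreal ((pi / 2)\<^sup>2) *
      (\<integral>\<^sup>+w. \<integral>\<^sup>+w'. ennreal ((\<Sum>i<m. coord_deriv i f (\<lambda>i. \<mu> i + Y i w) * Y i w')\<^sup>2) \<partial>M \<partial>M)"
proof -
  interpret M: prob_space M by fact
  interpret P: pair_prob_space M M ..
  interpret Q: pair_sigma_finite lborel "M \<Otimes>\<^sub>M M" ..
  have f_meas [measurable]: "f \<in> borel_measurable borel"
    using smooth_function_continuous[OF f] by (rule borel_measurable_continuous_onI)
  have f'_meas: "coord_deriv i f \<in> borel_measurable borel" if "i < m" for i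
    using smooth_function_continuous_deriv[OF f that] by (rule borel_measurable_continuous_onI)
  define x where "x z \<theta> i = \<mu> i + (cos \<theta> * Y i (fst z) + sin \<theta> * Y i (snd z))" for z \<theta> i
  define x' where "x' z \<theta> i = - sin \<theta> * Y i (fst z) + cos \<theta> * Y i (snd z)" for z \<theta> i
  define g where "g z \<theta> = (\<Sum>i<m. coord_deriv i f (x z \<theta>) * x' z \<theta> i)" for z \<theta>
  have x_deriv: "((\<lambda>\<theta>. x z \<theta> i) has_real_derivative x' z \<theta> i) (at \<theta>)" for z i \<theta>
    unfolding x_def x'_def by (auto intro!: derivative_eq_intros)
  have fx_deriv: "((\<lambda>\<theta>. f (x z \<theta>)) has_real_derivative g z \<theta>) (at \<theta>)" for z \<theta>
    unfolding g_def by (rule smooth_function_chain_rule[OF f x_deriv])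
  have x_cont: "continuous_on A (x z)" for A z
    unfolding x_def by (intro continuous_on_coordinatewise_then_product continuous_intros)
  have g_cont: "continuous_on A (g z)" for A z
    unfolding g_def x'_def
    by (intro continuous_intros continuous_on_compose2[OF smooth_function_continuous_deriv[OF f] x_cont]) auto
  have path: "ennreal ((f (\<lambda>i. \<mu> i + Y i (snd z)) - f (\<lambda>i. \<mu> i + Y i (fst z)))\<^sup>2) \<le>
      (\<integral>\<^sup>+\<theta>. ennreal (pi / 2 * (g z \<theta>)\<^sup>2) * indicator {0..pi / 2} \<theta> \<partial>lborel)" for z
    using ennreal_sq_diff_le_nn_integral[OF _ fx_deriv g_cont, of 0 "pi / 2" z] by (simp add: x_def[abs_def])
  define G where "G = (\<lambda>(y, y'). ennreal (pi / 2 * (\<Sum>i<m. coord_deriv i f (\<lambda>j. \<mu> j + y j) * y' i)\<^sup>2))"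
  have proj [measurable]: "(\<lambda>p. fst p i :: real) \<in> borel_measurable (borel \<Otimes>\<^sub>M borel)"
    "(\<lambda>p. snd p i :: real) \<in> borel_measurable (borel \<Otimes>\<^sub>M borel)" for i :: nat
    by (auto intro!: measurable_compose[OF measurable_fst] measurable_compose[OF measurable_snd]
        borel_measurable_continuous_onI continuous_on_product_coordinates)
  have sh: "(\<lambda>p. (\<lambda>j. \<mu> j + fst p j)) \<in> borel \<Otimes>\<^sub>M borel \<rightarrow>\<^sub>M borel"
    by (intro measurable_coordinatewise_then_product) measurable
  have G [measurable]: "G \<in> borel_measurable (borel \<Otimes>\<^sub>M borel)"
    unfolding G_def split_beta
    by (intro measurable_compose[OF _ measurable_ennreal] borel_measurable_times borel_measurable_power
        borel_measurable_sum borel_measurable_const measurable_compose[OF sh f'_meas] proj) auto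
  have gG: "ennreal (pi / 2 * (g z \<theta>)\<^sup>2) = G (\<lambda>i. cos \<theta> * Y i (fst z) + sin \<theta> * Y i (snd z),
                    \<lambda>i. - sin \<theta> * Y i (fst z) + cos \<theta> * Y i (snd z))" for z \<theta>
    by (simp add: G_def g_def x_def[abs_def] x'_def)
  have m1: "(\<lambda>p. (\<lambda>i. cos (fst p) * Y i (fst (snd p)) + sin (fst p) * Y i (snd (snd p))))
      \<in> lborel \<Otimes>\<^sub>M (M \<Otimes>\<^sub>M M) \<rightarrow>\<^sub>M borel"
    by (intro measurable_coordinatewise_then_product) measurable
  have m2: "(\<lambda>p. (\<lambda>i. - sin (fst p) * Y i (fst (snd p)) + cos (fst p) * Y i (snd (snd p))))
      \<in> lborel \<Otimes>\<^sub>M (M \<Otimes>\<^sub>M M) \<rightarrow>\<^sub>M borel"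
    by (intro measurable_coordinatewise_then_product) measurable
  have joint [measurable]: "(\<lambda>(\<theta>, z). ennreal (pi / 2 * (g z \<theta>)\<^sup>2) * indicator {0..pi / 2} \<theta>)
      \<in> borel_measurable (lborel \<Otimes>\<^sub>M (M \<Otimes>\<^sub>M M))"
    unfolding gG split_beta
    by (intro borel_measurable_times_ennreal measurable_compose[OF _ G] measurable_Pair m1 m2) measurable
  define J where "J = (\<integral>\<^sup>+w. \<integral>\<^sup>+w'. ennreal ((\<Sum>i<m. coord_deriv i f (\<lambda>i. \<mu> i + Y i w) * Y i w')\<^sup>2) \<partial>M \<partial>M)"
  have shY: "(\<lambda>w. (\<lambda>j. \<mu> j + Y j w)) \<in> M \<rightarrow>\<^sub>M borel"
    by (intro measurable_coordinatewise_then_product) measurable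
  have YY: "(\<lambda>z. (\<lambda>i. Y i (fst z), \<lambda>i. Y i (snd z))) \<in> M \<Otimes>\<^sub>M M \<rightarrow>\<^sub>M borel \<Otimes>\<^sub>M borel"
    by (intro measurable_Pair measurable_coordinatewise_then_product) measurable
  have rotate: "(\<integral>\<^sup>+z. ennreal (pi / 2 * (g z \<theta>)\<^sup>2) \<partial>(M \<Otimes>\<^sub>M M)) = ennreal (pi / 2) * J" for \<theta>
  proof -
    have d_meas: "(\<lambda>z. (\<Sum>i<m. coord_deriv i f (\<lambda>j. \<mu> j + Y j (fst z)) * Y i (snd z))\<^sup>2)
        \<in> borel_measurable (M \<Otimes>\<^sub>M M)"
      by (intro borel_measurable_power borel_measurable_sum borel_measurable_times
        measurable_compose[OF measurable_compose[OF measurable_fst shY] f'_meas]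
        measurable_compose[OF measurable_snd Y]) auto
    have "(\<integral>\<^sup>+z. ennreal (pi / 2 * (g z \<theta>)\<^sup>2) \<partial>(M \<Otimes>\<^sub>M M)) =
        (\<integral>\<^sup>+z. G (\<lambda>i. Y i (fst z), \<lambda>i. Y i (snd z)) \<partial>(M \<Otimes>\<^sub>M M))"
      unfolding gG by (rule gaussian_rotation_invariance[OF M Y gauss centred Y0 G])
    also have "\<dots> = (\<integral>\<^sup>+z. ennreal (pi / 2) *
        ennreal ((\<Sum>i<m. coord_deriv i f (\<lambda>j. \<mu> j + Y j (fst z)) * Y i (snd z))\<^sup>2) \<partial>(M \<Otimes>\<^sub>M M))"
      by (intro nn_integral_cong) (simp add: G_def ennreal_mult[symmetric])
    also have "\<dots> = ennreal (pi / 2) *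
        (\<integral>\<^sup>+z. ennreal ((\<Sum>i<m. coord_deriv i f (\<lambda>j. \<mu> j + Y j (fst z)) * Y i (snd z))\<^sup>2) \<partial>(M \<Otimes>\<^sub>M M))"
      using d_meas by (intro nn_integral_cmult) simp
    also have "(\<integral>\<^sup>+z. ennreal ((\<Sum>i<m. coord_deriv i f (\<lambda>j. \<mu> j + Y j (fst z)) * Y i (snd z))\<^sup>2) \<partial>(M \<Otimes>\<^sub>M M)) = J"
      unfolding J_def using d_meas by (subst M.nn_integral_fst[symmetric]) auto
    finally show ?thesis .
  qed
  have "(\<integral>\<^sup>+z. ennreal ((f (\<lambda>i. \<mu> i + Y i (snd z)) - f (\<lambda>i. \<mu> i + Y i (fst z)))\<^sup>2) \<partial>(M \<Otimes>\<^sub>M M)) \<le>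
     (\<integral>\<^sup>+z. \<integral>\<^sup>+\<theta>. ennreal (pi / 2 * (g z \<theta>)\<^sup>2) * indicator {0..pi / 2} \<theta> \<partial>lborel \<partial>(M \<Otimes>\<^sub>M M))"
    by (intro nn_integral_mono path)
  also have "\<dots> = (\<integral>\<^sup>+\<theta>. \<integral>\<^sup>+z. ennreal (pi / 2 * (g z \<theta>)\<^sup>2) * indicator {0..pi / 2} \<theta> \<partial>(M \<Otimes>\<^sub>M M) \<partial>lborel)"
    by (rule Q.Fubini'[OF joint])
  also have "\<dots> = (\<integral>\<^sup>+\<theta>. ennreal (pi / 2) * J * indicator {0..pi / 2} \<theta> \<partial>lborel)"
    using rotate by (intro nn_integral_cong) (simp add: indicator_def)
  also have "\<dots> = ennreal (pi / 2) * J * ennreal (pi / 2)"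
    by (subst nn_integral_cmult_indicator) auto
  also have "\<dots> = ennreal ((pi / 2)\<^sup>2) * J"
    unfolding power2_eq_square by (subst ennreal_mult) (simp_all only: mult_ac pi_half_ge_zero)
  finally show ?thesis unfolding J_def .
qed

text \<open>
  The mean square distance of two independent copies of a variable is twice its variance. The
  inner integral on the right is the variance of the linear functional whose coefficients are the
  gradient at \<open>Y w\<close>. It may integrate to infinity, hence the extended nonnegative integral.
\<close>

lemma gaussian_poincare:
  fixes Y :: "nat \<Rightarrow> 'w \<Rightarrow> real"
  assumes M: "prob_space M"
    and Y [measurable]: "\<And>i. Y i \<in> borel_measurable M"
    and gauss: "\<And>a. gaussian_variable M (\<lambda>w. \<Sum>i<m. a i * Y i w)"
    and centred: "\<And>a. (\<integral>w. (\<Sum>i<m. a i * Y i w) \<partial>M) = 0"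
    and Y0: "\<And>i w. m \<le> i \<Longrightarrow> Y i w = 0"
    and f: "smooth_function m f"
    and bdd: "\<And>w. w \<in> space M \<Longrightarrow> \<bar>f (\<lambda>i. \<mu> i + Y i w)\<bar> \<le> B"
  shows "(\<integral>\<^sup>+w. ennreal ((f (\<lambda>i. \<mu> i + Y i w))\<^sup>2) \<partial>M) \<le>
    ennreal ((\<integral>w. f (\<lambda>i. \<mu> i + Y i w) \<partial>M)\<^sup>2) + ennreal (pi\<^sup>2 / 8) *
      (\<integral>\<^sup>+w. ennreal (\<integral>w'. (\<Sum>i<m. coord_deriv i f (\<lambda>i. \<mu> i + Y i w) * Y i w')\<^sup>2 \<partial>M) \<partial>M)"
proof -
  interpret M: prob_space M by fact
  interpret P: pair_prob_space M M ..
  define F where "F w = f (\<lambda>i. \<mu> i + Y i w)" for w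
  have f_meas [measurable]: "f \<in> borel_measurable borel"
    using smooth_function_continuous[OF f] by (rule borel_measurable_continuous_onI)
  have shY: "(\<lambda>w. (\<lambda>j. \<mu> j + Y j w)) \<in> M \<rightarrow>\<^sub>M borel"
    by (intro measurable_coordinatewise_then_product) measurable
  have [measurable]: "F \<in> borel_measurable M"
    unfolding F_def by (rule measurable_compose[OF shY f_meas])
  have FB: "\<bar>F w\<bar> \<le> B" if "w \<in> space M" for w
    using bdd[OF that] by (simp add: F_def)
  have FB2: "(F w)\<^sup>2 \<le> B\<^sup>2" if "w \<in> space M" for w
    using power_mono[OF FB[OF that], of 2] by simp
  have iF: "integrable M F" "integrable M (\<lambda>w. (F w)\<^sup>2)"
    using FB FB2
    by (auto intro!: M.integrable_const_bound[where B=B] M.integrable_const_bound[where B="B\<^sup>2" and f="\<lambda>w. (F w)\<^sup>2"])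
  define e where "e = (\<integral>w. F w \<partial>M)"
  define A where "A = (\<integral>w. (F w)\<^sup>2 \<partial>M)"
  have "(\<integral>\<^sup>+z. ennreal ((F (snd z) - F (fst z))\<^sup>2) \<partial>(M \<Otimes>\<^sub>M M)) =
      (\<integral>\<^sup>+w. \<integral>\<^sup>+w'. ennreal ((F w' - F w)\<^sup>2) \<partial>M \<partial>M)"
    by (subst M.nn_integral_fst[symmetric]) auto
  also have "\<dots> = (\<integral>\<^sup>+w. ennreal (A - 2 * e * F w + (F w)\<^sup>2) \<partial>M)"
  proof (intro nn_integral_cong)
    fix w
    have "(\<integral>\<^sup>+w'. ennreal ((F w' - F w)\<^sup>2) \<partial>M) = (\<integral>\<^sup>+w'. ennreal ((F w')\<^sup>2 - 2 * F w * F w' + (F w)\<^sup>2) \<partial>M)"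
      by (intro nn_integral_cong) (simp add: power2_eq_square algebra_simps)
    also have "\<dots> = ennreal (\<integral>w'. (F w')\<^sup>2 - 2 * F w * F w' + (F w)\<^sup>2 \<partial>M)"
    proof (intro nn_integral_eq_integral AE_I2)
      show "integrable M (\<lambda>w'. (F w')\<^sup>2 - 2 * F w * F w' + (F w)\<^sup>2)"
        using iF by auto
      have "(F w')\<^sup>2 - 2 * F w * F w' + (F w)\<^sup>2 = (F w' - F w)\<^sup>2" for w'
        by (simp add: power2_eq_square algebra_simps)
      then show "0 \<le> (F w')\<^sup>2 - 2 * F w * F w' + (F w)\<^sup>2" for w'
        by simp
    qed
    also have "(\<integral>w'. (F w')\<^sup>2 - 2 * F w * F w' + (F w)\<^sup>2 \<partial>M) = A - 2 * e * F w + (F w)\<^sup>2"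
      using iF by (simp add: A_def e_def M.prob_space)
    finally show "(\<integral>\<^sup>+w'. ennreal ((F w' - F w)\<^sup>2) \<partial>M) = ennreal (A - 2 * e * F w + (F w)\<^sup>2)" .
  qed
  also have "\<dots> = ennreal (\<integral>w. A - 2 * e * F w + (F w)\<^sup>2 \<partial>M)"
  proof (intro nn_integral_eq_integral AE_I2)
    show "integrable M (\<lambda>w. A - 2 * e * F w + (F w)\<^sup>2)"
      using iF by auto
    have "0 \<le> (\<integral>w. (F w - e)\<^sup>2 \<partial>M)"
      by (intro Bochner_Integration.integral_nonneg) simp
    also have "\<dots> = (\<integral>w. (F w)\<^sup>2 - 2 * e * F w + e\<^sup>2 \<partial>M)"
      by (intro Bochner_Integration.integral_cong) (simp_all add: power2_eq_square algebra_simps)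
    also have "\<dots> = A - e\<^sup>2"
      using iF by (simp add: A_def e_def M.prob_space power2_eq_square)
    finally have "e\<^sup>2 \<le> A" by simp
    then show "0 \<le> A - 2 * e * F w + (F w)\<^sup>2" for w
      using zero_le_power2[of "F w - e"] by (simp add: power2_eq_square algebra_simps)
  qed
  also have "(\<integral>w. A - 2 * e * F w + (F w)\<^sup>2 \<partial>M) = 2 * A - 2 * e\<^sup>2"
    using iF by (simp add: A_def e_def M.prob_space power2_eq_square)
  finally have sym: "(\<integral>\<^sup>+z. ennreal ((F (snd z) - F (fst z))\<^sup>2) \<partial>(M \<Otimes>\<^sub>M M)) = ennreal (2 * A - 2 * e\<^sup>2)" .
  define J where "J = (\<integral>\<^sup>+w. ennreal (\<integral>w'. (\<Sum>i<m. coord_deriv i f (\<lambda>i. \<mu> i + Y i w) * Y i w')\<^sup>2 \<partial>M) \<partial>M)"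
  have J: "(\<integral>\<^sup>+w. \<integral>\<^sup>+w'. ennreal ((\<Sum>i<m. coord_deriv i f (\<lambda>i. \<mu> i + Y i w) * Y i w')\<^sup>2) \<partial>M \<partial>M) = J"
    unfolding J_def using gauss
    by (intro nn_integral_cong nn_integral_eq_integral gaussian_variable_square_integrable(2) M) auto
  have le: "ennreal (2 * A - 2 * e\<^sup>2) \<le> ennreal ((pi / 2)\<^sup>2) * J"
    unfolding sym[symmetric] J[symmetric] F_def by (rule gaussian_poincare_two_copies[OF M Y gauss centred Y0 f])
  have "ennreal A \<le> ennreal (e\<^sup>2 + (A - e\<^sup>2))" by simp
  also have "\<dots> \<le> ennreal (e\<^sup>2) + ennreal (A - e\<^sup>2)"
    by (cases "0 \<le> A - e\<^sup>2") (auto simp: ennreal_neg intro: ennreal_leI simp flip: ennreal_plus)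
  also have "ennreal (A - e\<^sup>2) = ennreal (1/2) * ennreal (2 * A - 2 * e\<^sup>2)"
    by (subst ennreal_mult'[symmetric]) (simp_all add: diff_divide_distrib)
  also have "\<dots> \<le> ennreal (1/2) * (ennreal ((pi / 2)\<^sup>2) * J)"
    by (intro mult_left_mono le) auto
  also have "\<dots> = ennreal (pi\<^sup>2 / 8) * J"
    unfolding mult.assoc[symmetric] by (subst ennreal_mult'[symmetric]) (auto simp: power2_eq_square)
  finally have "ennreal A \<le> ennreal (e\<^sup>2) + ennreal (pi\<^sup>2 / 8) * J" by (simp add: add_left_mono)
  moreover have "(\<integral>\<^sup>+w. ennreal ((F w)\<^sup>2) \<partial>M) = ennreal A"
    unfolding A_def using iF by (intro nn_integral_eq_integral) auto
  ultimately show ?thesis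
    unfolding J_def F_def[symmetric] e_def by simp
qed

section \<open>Test functions and distributions\<close>

lemma test_functions_differentiable:
  assumes "\<phi> \<in> test_functions" and "vs \<in> lists Basis"
  shows "foldr dir_deriv vs \<phi> differentiable (at x)"
  using assms unfolding test_functions_def by blast

lemma test_functions_continuous:
  assumes "\<phi> \<in> test_functions"
  shows "continuous_on A \<phi>"
  using test_functions_differentiable[OF assms, of "[]"]
  by (auto intro!: continuous_at_imp_continuous_on differentiable_imp_continuous_within)

lemma foldr_dir_deriv_lincomb:
  assumes \<phi>: "\<phi> \<in> test_functions" and \<psi>: "\<psi> \<in> test_functions" and "vs \<in> lists Basis"
  shows "foldr dir_deriv vs (\<lambda>x. a *\<^sub>R \<phi> x + b *\<^sub>R \<psi> x) =
    (\<lambda>x. a *\<^sub>R foldr dir_deriv vs \<phi> x + b *\<^sub>R foldr dir_deriv vs \<psi> x)"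
  using assms(3)
proof (induction vs rule: list.induct)
  case (Cons v vs)
  then have vs: "vs \<in> lists Basis" by simp
  let ?A = "foldr dir_deriv vs \<phi>" and ?B = "foldr dir_deriv vs \<psi>"
  have fd: "frechet_derivative (\<lambda>x. a *\<^sub>R ?A x + b *\<^sub>R ?B x) (at x) =
      (\<lambda>h. a *\<^sub>R frechet_derivative ?A (at x) h + b *\<^sub>R frechet_derivative ?B (at x) h)" for x
    using test_functions_differentiable[OF \<phi> vs, of x] test_functions_differentiable[OF \<psi> vs, of x]
    by (intro frechet_derivative_at[symmetric] derivative_intros) (simp_all add: frechet_derivative_works[symmetric])
  show ?case
    unfolding foldr.simps comp_apply Cons.IH[OF vs] by (simp add: dir_deriv_def fd)
qed simp

lemma test_functions_lincomb:
  assumes "\<phi> \<in> test_functions" and "\<psi> \<in> test_functions"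
  shows "(\<lambda>x. a *\<^sub>R \<phi> x + b *\<^sub>R \<psi> x) \<in> test_functions"
proof -
  have "torus_periodic (\<lambda>x. a *\<^sub>R \<phi> x + b *\<^sub>R \<psi> x)"
    using assms by (simp add: test_functions_def torus_periodic_def)
  moreover have "foldr dir_deriv vs (\<lambda>x. a *\<^sub>R \<phi> x + b *\<^sub>R \<psi> x) differentiable (at x)"
    if "vs \<in> lists Basis" for vs x
    unfolding foldr_dir_deriv_lincomb[OF assms that]
    using test_functions_differentiable[OF assms(1) that] test_functions_differentiable[OF assms(2) that]
    by simp
  ultimately show ?thesis by (simp add: test_functions_def)
qed

lemma test_functions_zero: "(\<lambda>x::real^'n. 0 :: 'e::euclidean_space) \<in> test_functions"
proof -
  have "foldr dir_deriv vs (\<lambda>x::real^'n. 0 :: 'e) = (\<lambda>x. 0)" for vs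
  proof (induction vs)
    case (Cons v vs)
    show ?case unfolding foldr.simps comp_apply Cons by (simp add: dir_deriv_def)
  qed simp
  then show ?thesis by (simp add: test_functions_def torus_periodic_def)
qed

lemma test_functions_scale:
  assumes "\<phi> \<in> test_functions"
  shows "(\<lambda>x. a *\<^sub>R \<phi> x) \<in> test_functions"
  using test_functions_lincomb[OF assms assms, of a 0] by simp

lemma test_functions_sum:
  fixes m :: nat
  assumes "\<And>i. i < m \<Longrightarrow> \<phi> i \<in> test_functions"
  shows "(\<lambda>x. \<Sum>i<m. a i *\<^sub>R \<phi> i x) \<in> test_functions"
  using assms
proof (induction m)
  case (Suc m)
  then show ?case
    using test_functions_lincomb[of "\<lambda>x. \<Sum>i<m. a i *\<^sub>R \<phi> i x" "\<phi> m" 1 "a m"] by simp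
qed (simp add: test_functions_zero)

lemma distributions_scale:
  assumes "\<xi> \<in> distributions" and "\<phi> \<in> test_functions"
  shows "\<xi> (\<lambda>x. c *\<^sub>R \<phi> x) = c * \<xi> \<phi>"
  using assms unfolding distributions_def by blast

lemma distributions_sum:
  fixes m :: nat
  assumes \<xi>: "\<xi> \<in> distributions" and "\<And>i. i < m \<Longrightarrow> \<phi> i \<in> test_functions"
  shows "\<xi> (\<lambda>x. \<Sum>i<m. a i *\<^sub>R \<phi> i x) = (\<Sum>i<m. a i * \<xi> (\<phi> i))"
  using assms(2)
proof (induction m)
  case 0
  show ?case using distributions_scale[OF \<xi> test_functions_zero, of 0] by simp
next
  case (Suc m)
  have add: "\<xi> (\<lambda>x. \<phi> x + \<psi> x) = \<xi> \<phi> + \<xi> \<psi>" if "\<phi> \<in> test_functions" "\<psi> \<in> test_functions" for \<phi> \<psi>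
    using \<xi> that unfolding distributions_def by blast
  show ?case
    using Suc add[OF test_functions_sum[of m \<phi> a] test_functions_scale[of "\<phi> m" "a m"]]
    by (simp add: distributions_scale[OF \<xi>])
qed

section \<open>Integrals and integrable singularities on the torus\<close>

lemma prod_mono_ennreal:
  fixes f g :: "'a \<Rightarrow> ennreal"
  assumes "\<And>i. i \<in> A \<Longrightarrow> f i \<le> g i"
  shows "prod f A \<le> prod g A"
  using assms by (induction A rule: infinite_finite_induct) (auto intro!: mult_mono)

text \<open>
  Multiplication by a positive constant permutes the simple functions, whose suprema define both
  integrals. The rule for arbitrary \<open>f\<close> serves for functions such as
  \<open>w \<mapsto> N (cyl_deriv m \<phi> f (X w))\<close>, whose measurability is not known for an arbitrary functional \<open>N\<close>.
\<close>

lemma nn_integral_cmult_real: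
  assumes "0 \<le> c"
  shows "(\<integral>\<^sup>+x. ennreal c * f x \<partial>M) = ennreal c * (\<integral>\<^sup>+x. f x \<partial>M)"
proof (cases "c = 0")
  case False
  \<comment> \<open>It suffices to compare with simple functions below \<open>c * f\<close>, which are measurable; the other
    inequality is this one for \<open>1 / c\<close>.\<close>
  have le: "(\<integral>\<^sup>+x. ennreal c * f x \<partial>M) \<le> ennreal c * (\<integral>\<^sup>+x. f x \<partial>M)" if c: "0 < c" for c f
  proof -
    have cc: "ennreal c * (ennreal (1 / c) * z) = z" "ennreal (1 / c) * (ennreal c * z) = z" for z
      using c by (simp_all add: mult.assoc[symmetric] ennreal_mult[symmetric])
    have "integral\<^sup>S M g \<le> ennreal c * (\<integral>\<^sup>+x. f x \<partial>M)"
      if g: "simple_function M g" and gf: "g \<le> (\<lambda>x. ennreal c * f x)" for g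
    proof -
      have "integral\<^sup>S M g = (\<integral>\<^sup>+x. ennreal c * (ennreal (1 / c) * g x) \<partial>M)"
        unfolding cc by (rule nn_integral_eq_simple_integral[OF g, symmetric])
      also have "\<dots> = ennreal c * (\<integral>\<^sup>+x. ennreal (1 / c) * g x \<partial>M)"
        using borel_measurable_simple_function[OF g] by (intro nn_integral_cmult) measurable
      also have "\<dots> \<le> ennreal c * (\<integral>\<^sup>+x. ennreal (1 / c) * (ennreal c * f x) \<partial>M)"
        using gf by (intro mult_left_mono nn_integral_mono) (auto simp: le_fun_def)
      finally show ?thesis unfolding cc .
    qed
    then show ?thesis
      unfolding nn_integral_def[of M "\<lambda>x. ennreal c * f x"] by (intro SUP_least) auto
  qed
  have c: "0 < c" using assms False by simp
  have cc: "ennreal c * (ennreal (1 / c) * z) = z" "ennreal (1 / c) * (ennreal c * z) = z" for z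
    using c by (simp_all add: mult.assoc[symmetric] ennreal_mult[symmetric])
  have "ennreal c * (\<integral>\<^sup>+x. f x \<partial>M) = ennreal c * (\<integral>\<^sup>+x. ennreal (1 / c) * (ennreal c * f x) \<partial>M)"
    unfolding cc ..
  also have "\<dots> \<le> ennreal c * (ennreal (1 / c) * (\<integral>\<^sup>+x. ennreal c * f x \<partial>M))"
    using c by (intro mult_left_mono le) auto
  finally have "ennreal c * (\<integral>\<^sup>+x. f x \<partial>M) \<le> (\<integral>\<^sup>+x. ennreal c * f x \<partial>M)"
    unfolding cc .
  then show ?thesis using le[OF c, of f] by (rule antisym[rotated])
qed simp

lemma ennreal_norm_integral_le:
  fixes f :: "'a \<Rightarrow> 'b::{banach, second_countable_topology}"
  shows "ennreal (norm (integral\<^sup>L M f)) \<le> (\<integral>\<^sup>+x. ennreal (norm (f x)) \<partial>M)"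
  by (cases "integrable M f") (auto simp: integral_norm_bound_ennreal not_integrable_integral_eq)

lemma nn_integral_torus_measure:
  "(\<integral>\<^sup>+x. f x \<partial>torus_measure) = (\<integral>\<^sup>+x. f x * indicator (cbox 0 1) x \<partial>lborel)"
  unfolding torus_measure_def
  by (subst nn_integral_restrict_space) (simp_all add: nn_integral_completion)

lemma one_vec_eq_One: "(1 :: real ^ 'n) = One"
proof (rule euclidean_eqI)
  fix b :: "real ^ 'n"
  assume b: "b \<in> Basis"
  then obtain i where "b = axis i 1" by (auto simp: Basis_vec_def)
  then have "(1 :: real ^ 'n) \<bullet> b = 1" by (simp add: inner_axis)
  then show "(1 :: real ^ 'n) \<bullet> b = One \<bullet> b" using b by simp
qed

lemma integral_torus_one: "(\<integral>x. 1 \<partial>(torus_measure :: (real ^ 'n) measure)) = (1 :: real)"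
proof -
  have "emeasure (torus_measure :: (real ^ 'n) measure) (space torus_measure) = (\<integral>\<^sup>+x. 1 \<partial>(torus_measure :: (real ^ 'n) measure))"
    by simp
  also have "\<dots> = emeasure lborel (cbox 0 1 :: (real ^ 'n) set)"
    unfolding nn_integral_torus_measure by simp
  also have "\<dots> = 1"
    unfolding one_vec_eq_One emeasure_lborel_cbox_eq by simp
  finally show ?thesis by (simp add: measure_def)
qed

lemma integrable_torus_powr:
  fixes D :: "real ^ 'n \<Rightarrow> 'e::euclidean_space"
  assumes D: "continuous_on UNIV D" and s: "0 < s"
  shows "integrable torus_measure (\<lambda>x. norm (D x) powr s)"
  unfolding torus_measure_def
  using D s by (intro continuous_imp_integrable continuous_on_powr' continuous_on_norm continuous_on_const)
    (auto intro: continuous_on_subset)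

definition dist_int :: "real \<Rightarrow> real" where
  "dist_int t = infdist t \<int>"

lemma Ints_nonempty: "(\<int> :: real set) \<noteq> {}"
  using Ints_0 by blast

lemma dist_int_attained: "\<exists>k. dist_int t = \<bar>t - of_int k\<bar>"
  using infdist_attains_inf[OF closed_Ints Ints_nonempty, of t]
  by (auto simp: dist_int_def dist_real_def elim!: Ints_cases)

lemma dist_int_le: "dist_int t \<le> \<bar>t - of_int k\<bar>"
  unfolding dist_int_def using infdist_le[of "of_int k" \<int> t] by (simp add: dist_real_def)

lemma dist_int_pos: "t \<notin> \<int> \<Longrightarrow> 0 < dist_int t"
  unfolding dist_int_def by (rule infdist_pos_not_in_closed[OF closed_Ints Ints_nonempty])

lemma dist_int_uminus: "dist_int (- t) = dist_int t"
proof -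
  have "dist_int (- t) \<le> dist_int t" for t
  proof -
    obtain k where "dist_int t = \<bar>t - of_int k\<bar>" using dist_int_attained by blast
    then show ?thesis using dist_int_le[of "- t" "- k"] by simp
  qed
  from this[of t] this[of "- t"] show ?thesis by simp
qed

lemma measurable_dist_int [measurable]: "dist_int \<in> borel_measurable borel"
  unfolding dist_int_def[abs_def]
  by (intro borel_measurable_continuous_onI continuous_intros)

text \<open>
  A majorant of the isotropic singularity that factorises over the coordinates, so that its integral
  reduces to integrals on the line. On the grid where some coordinate is an integer it vanishes,
  because \<open>0 powr x = 0\<close>; the grid is a null set.
\<close>

definition int_kernel :: "real \<Rightarrow> 'a::euclidean_space \<Rightarrow> real" where
  "int_kernel \<alpha> z = (\<Prod>b\<in>Basis. dist_int (z \<bullet> b) powr (- \<alpha>))"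

lemma int_kernel_nonneg: "0 \<le> int_kernel \<alpha> z"
  unfolding int_kernel_def by (intro prod_nonneg) auto

lemma int_kernel_uminus: "int_kernel \<alpha> (- z) = int_kernel \<alpha> z"
  by (simp add: int_kernel_def dist_int_uminus)

lemma int_kernel_powr: "int_kernel \<alpha> z powr r = int_kernel (\<alpha> * r) z"
  unfolding int_kernel_def by (subst prod_powr_distrib) (simp_all add: powr_powr)

lemma measurable_int_kernel [measurable]: "int_kernel \<alpha> \<in> borel_measurable borel"
  unfolding int_kernel_def[abs_def] by measurable

lemma dist_int_le_torus_abs:
  assumes "b \<in> Basis"
  shows "dist_int (z \<bullet> b) \<le> torus_abs z"
proof -
  have b: "(0 :: real ^ 'n) \<in> int_lattice" by (simp add: int_lattice_def)
  obtain i where i: "b = axis i 1" using assms by (auto simp: Basis_vec_def)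
  have "dist_int (z $ i) \<le> dist z k" if "k \<in> int_lattice" for k
  proof -
    obtain l where "k $ i = of_int l" using \<open>k \<in> int_lattice\<close> by (auto simp: int_lattice_def elim: Ints_cases)
    then have "dist_int (z $ i) \<le> dist (z $ i) (k $ i)" by (simp add: dist_real_def dist_int_le)
    also have "\<dots> \<le> dist z k" by (rule dist_vec_nth_le)
    finally show ?thesis .
  qed
  then show ?thesis
    unfolding torus_abs_def infdist_def i inner_axis using b by (auto intro!: cINF_greatest)
qed

text \<open>
  The geodesic distance dominates the distance to the integers in each of the \<open>n\<close> coordinates, hence
  also their geometric mean.
\<close>

lemma torus_abs_powr_le_int_kernel:
  fixes z :: "real ^ 'n"
  assumes "0 \<le> \<beta>" and z: "\<And>b. b \<in> Basis \<Longrightarrow> z \<bullet> b \<notin> \<int>"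
  shows "torus_abs z powr (- \<beta>) \<le> int_kernel (\<beta> / real CARD('n)) z"
proof -
  have pos: "0 < torus_abs z"
    using dist_int_pos[OF z[OF SOME_Basis]] dist_int_le_torus_abs[OF SOME_Basis, of z] by linarith
  have "torus_abs z powr (- \<beta>) = (\<Prod>b\<in>(Basis :: (real ^ 'n) set). torus_abs z powr (- (\<beta> / real CARD('n))))"
    using pos by (subst prod_constant, subst powr_power) auto
  also have "\<dots> \<le> int_kernel (\<beta> / real CARD('n)) z"
    unfolding int_kernel_def
    using assms dist_int_le_torus_abs[of _ z] dist_int_pos[OF z]
    by (intro prod_mono conjI powr_mono2') auto
  finally show ?thesis .
qed

lemma AE_torus_not_Ints:
  fixes x :: "real ^ 'n"
  shows "AE y in torus_measure. \<forall>b\<in>Basis. (x - y) \<bullet> b \<notin> \<int>"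
proof -
  have "AE y in lebesgue. (x - y) \<bullet> b \<notin> \<int>" if "b \<in> Basis" for b :: "real ^ 'n"
  proof -
    have "AE y in lebesgue. \<forall>k::int. y \<bullet> b \<noteq> x \<bullet> b - of_int k"
    proof (intro AE_all_countable[THEN iffD2] allI)
      fix k :: int
      show "AE y in lebesgue. y \<bullet> b \<noteq> x \<bullet> b - of_int k"
        using negligible_standard_hyperplane[OF that, of "x \<bullet> b - of_int k"]
        unfolding negligible_iff_null_sets by (rule AE_I') auto
    qed
    then show ?thesis
    proof (eventually_elim)
      case (elim y)
      then show ?case by (auto elim!: Ints_cases simp: inner_diff_left) (metis add_diff_cancel_left' diff_add_cancel)
    qed
  qed
  then have "AE y in lebesgue. \<forall>b\<in>Basis. (x - y) \<bullet> b \<notin> \<int>"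
    by (intro AE_finite_allI) auto
  then show ?thesis
    unfolding torus_measure_def by (subst AE_restrict_space_iff) auto
qed

lemma nn_integral_abs_powr_finite:
  assumes "\<alpha> < 1"
  obtains L where "0 \<le> L" "(\<integral>\<^sup>+t. ennreal (\<bar>t\<bar> powr (- \<alpha>)) * indicator {- c..c} t \<partial>lborel) \<le> ennreal L"
proof -
  define c' where "c' = max c 0"
  define g where "g t = t powr (- \<alpha>) * indicator {0..c'} t" for t :: real
  have g_meas [measurable]: "g \<in> borel_measurable borel" unfolding g_def by measurable
  have g_nonneg: "0 \<le> g t" for t by (simp add: g_def)
  define L where "L = c' powr (- \<alpha> + 1) / (- \<alpha> + 1)"
  have L: "0 \<le> L" using assms by (simp add: L_def)
  have "((\<lambda>t. t powr (- \<alpha>)) has_integral L) {0..c'}"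
    unfolding L_def using assms by (intro has_integral_powr_from_0) (auto simp: c'_def)
  moreover have "g = (\<lambda>t. if t \<in> {0..c'} then t powr (- \<alpha>) else 0)"
    by (auto simp: g_def indicator_def)
  ultimately have "(g has_integral L) UNIV"
    by (simp only: has_integral_restrict_UNIV)
  with g_meas have g: "(\<integral>\<^sup>+t. ennreal (g t) \<partial>lborel) = ennreal L"
    by (intro nn_integral_has_integral_lborel) (simp_all add: g_nonneg)
  have g': "(\<integral>\<^sup>+t. ennreal (g (- t)) \<partial>lborel) = ennreal L"
    using nn_integral_real_affine[of "\<lambda>t. ennreal (g t)" "-1" 0] g by (simp add: g_def)
  have "(\<integral>\<^sup>+t. ennreal (\<bar>t\<bar> powr (- \<alpha>)) * indicator {- c..c} t \<partial>lborel) \<le>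
      (\<integral>\<^sup>+t. ennreal (g t) + ennreal (g (- t)) \<partial>lborel)"
    by (intro nn_integral_mono) (auto simp: g_def c'_def indicator_def)
  also have "\<dots> = ennreal L + ennreal L"
    by (subst nn_integral_add) (simp_all add: g g')
  also have "\<dots> = ennreal (2 * L)"
    using L by (simp flip: ennreal_plus)
  finally show ?thesis using L that[of "2 * L"] by simp
qed

text \<open>
  For \<open>u\<close> and \<open>t\<close> in the unit interval the integer nearest to \<open>u - t\<close> lies between \<open>-2\<close> and \<open>2\<close>, so five
  translates of the singularity at the origin dominate the integrand.
\<close>

lemma nn_integral_dist_int_powr_bounded:
  assumes "\<alpha> < 1"
  obtains L where "0 \<le> L" "\<And>u. 0 \<le> u \<Longrightarrow> u \<le> 1 \<Longrightarrow>
    (\<integral>\<^sup>+t. ennreal (dist_int (u - t) powr (- \<alpha>)) * indicator {0..1} t \<partial>lborel) \<le> ennreal L"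
proof -
  obtain L where L: "0 \<le> L" "(\<integral>\<^sup>+t. ennreal (\<bar>t\<bar> powr (- \<alpha>)) * indicator {-3..3} t \<partial>lborel) \<le> ennreal L"
    using nn_integral_abs_powr_finite[OF assms, of 3] by metis
  have "(\<integral>\<^sup>+t. ennreal (dist_int (u - t) powr (- \<alpha>)) * indicator {0..1} t \<partial>lborel) \<le> ennreal (5 * L)"
    if u: "0 \<le> u" "u \<le> 1" for u
  proof -
    define f where "f s = ennreal (\<bar>s\<bar> powr (- \<alpha>)) * indicator {-3..3} s" for s :: real
    have [measurable]: "f \<in> borel_measurable borel" unfolding f_def by measurable
    have "ennreal (dist_int (u - t) powr (- \<alpha>)) * indicator {0..1} t \<le>
        (\<Sum>j\<in>{-2..2::int}. f (u - of_int j + (-1) * t))" for t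
    proof (cases "t \<in> {0..1}")
      case True
      obtain k where k: "dist_int (u - t) = \<bar>u - t - of_int k\<bar>" using dist_int_attained by blast
      have "\<bar>u - t - of_int k\<bar> \<le> 1" using k dist_int_le[of "u - t" 0] u True by auto
      then have "\<bar>real_of_int k\<bar> \<le> 2" using u True by auto
      then have k2: "k \<in> {-2..2}" by auto
      have "ennreal (dist_int (u - t) powr (- \<alpha>)) * indicator {0..1} t = f (u - of_int k + (-1) * t)"
        using True u k2 k by (auto simp: f_def indicator_def algebra_simps)
      also have "\<dots> \<le> (\<Sum>j\<in>{-2..2::int}. f (u - of_int j + (-1) * t))"
        using k2 by (intro member_le_sum) auto
      finally show ?thesis .
    qed simp
    then have "(\<integral>\<^sup>+t. ennreal (dist_int (u - t) powr (- \<alpha>)) * indicator {0..1} t \<partial>lborel) \<le>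
        (\<integral>\<^sup>+t. (\<Sum>j\<in>{-2..2::int}. f (u - of_int j + (-1) * t)) \<partial>lborel)"
      by (rule nn_integral_mono)
    also have "\<dots> = (\<Sum>j\<in>{-2..2::int}. \<integral>\<^sup>+t. f (u - of_int j + (-1) * t) \<partial>lborel)"
      by (rule nn_integral_sum) simp
    also have "\<dots> = (\<Sum>j\<in>{-2..2::int}. \<integral>\<^sup>+t. f t \<partial>lborel)"
      by (intro sum.cong refl) (subst nn_integral_real_affine[of f "-1"], auto)
    also have "\<dots> \<le> (\<Sum>j\<in>{-2..2::int}. ennreal L)"
      using L by (intro sum_mono) (simp add: f_def)
    also have "\<dots> = ennreal (5 * L)"
      using L by (simp add: ennreal_mult ennreal_of_nat_eq_real_of_nat)
    finally show ?thesis .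
  qed
  then show ?thesis using L that[of "5 * L"] by simp
qed

lemma nn_integral_int_kernel_bounded:
  assumes "\<alpha> < 1"
  obtains L where "0 \<le> L" "\<And>x :: 'a::euclidean_space. x \<in> cbox 0 One \<Longrightarrow>
    (\<integral>\<^sup>+y. ennreal (int_kernel \<alpha> (x - y)) * indicator (cbox 0 One) y \<partial>lborel) \<le> ennreal L"
proof -
  obtain L where L: "0 \<le> L" "\<And>u. 0 \<le> u \<Longrightarrow> u \<le> 1 \<Longrightarrow>
    (\<integral>\<^sup>+t. ennreal (dist_int (u - t) powr (- \<alpha>)) * indicator {0..1} t \<partial>lborel) \<le> ennreal L"
    using nn_integral_dist_int_powr_bounded[OF assms] by metis
  have "(\<integral>\<^sup>+y. ennreal (int_kernel \<alpha> (x - y)) * indicator (cbox 0 One) y \<partial>lborel) \<le> ennreal (L ^ DIM('a))"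
    if x: "x \<in> cbox 0 One" for x :: 'a
  proof -
    have "indicator (cbox 0 One) y = (\<Prod>b\<in>Basis. indicator {0..1} (y \<bullet> b) :: ennreal)" for y :: 'a
      by (auto simp: indicator_def mem_box prod_zero_iff)
    then have "(\<integral>\<^sup>+y. ennreal (int_kernel \<alpha> (x - y)) * indicator (cbox 0 One) y \<partial>lborel) =
      (\<integral>\<^sup>+y. (\<Prod>b\<in>Basis. ennreal (dist_int (x \<bullet> b - y \<bullet> b) powr (- \<alpha>)) * indicator {0..1} (y \<bullet> b)) \<partial>lborel)"
      by (simp add: int_kernel_def prod_ennreal[symmetric] prod.distrib inner_diff_left)
    also have "\<dots> = (\<Prod>b\<in>(Basis :: 'a set). \<integral>\<^sup>+t. ennreal (dist_int (x \<bullet> b - t) powr (- \<alpha>)) * indicator {0..1} t \<partial>lborel)"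
      by (subst nn_integral_lborel_prod) auto
    also have "\<dots> \<le> (\<Prod>b\<in>(Basis :: 'a set). ennreal L)"
      using x by (intro prod_mono_ennreal L(2)) (auto simp: mem_box)
    also have "\<dots> = ennreal (L ^ DIM('a))"
      using L by (simp add: ennreal_power)
    finally show ?thesis .
  qed
  then show ?thesis using L that[of "L ^ DIM('a)"] by simp
qed

lemma norm_le_int_kernel:
  fixes C :: "real ^ 'n \<Rightarrow> 'e::real_normed_vector"
  assumes \<gamma>: "0 \<le> \<gamma>" and bdd: "bdd_above ((\<lambda>x. torus_abs x powr \<gamma> * norm (C x)) ` (- int_lattice))"
  obtains B where "0 \<le> B" and "\<And>z. (\<And>b. b \<in> Basis \<Longrightarrow> z \<bullet> b \<notin> \<int>) \<Longrightarrow>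
    norm (C z) \<le> B * int_kernel (\<gamma> / real CARD('n)) z"
proof -
  obtain B where B: "\<And>z. z \<notin> int_lattice \<Longrightarrow> torus_abs z powr \<gamma> * norm (C z) \<le> B"
    using bdd unfolding bdd_above_def by auto
  have "norm (C z) \<le> max B 0 * int_kernel (\<gamma> / real CARD('n)) z"
    if z: "\<And>b. b \<in> Basis \<Longrightarrow> z \<bullet> b \<notin> \<int>" for z
  proof -
    have t: "0 < torus_abs z"
      using dist_int_pos[OF z[OF SOME_Basis]] dist_int_le_torus_abs[OF SOME_Basis, of z] by linarith
    have "z \<bullet> axis i 1 \<notin> \<int>" for i by (rule z) (auto simp: Basis_vec_def)
    then have "z \<notin> int_lattice" by (auto simp: int_lattice_def inner_axis)
    then have "torus_abs z powr \<gamma> * norm (C z) \<le> max B 0"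
      using B[of z] by simp
    then have "torus_abs z powr (- \<gamma>) * (torus_abs z powr \<gamma> * norm (C z)) \<le> torus_abs z powr (- \<gamma>) * max B 0"
      by (rule mult_left_mono) simp
    moreover have "torus_abs z powr (- \<gamma>) * (torus_abs z powr \<gamma> * norm (C z)) = norm (C z)"
      using t by (simp add: mult.assoc[symmetric] powr_add[symmetric])
    ultimately have "norm (C z) \<le> max B 0 * torus_abs z powr (- \<gamma>)"
      by (simp only: mult.commute)
    also have "\<dots> \<le> max B 0 * int_kernel (\<gamma> / real CARD('n)) z"
      using \<gamma> z by (intro mult_left_mono torus_abs_powr_le_int_kernel) auto
    finally show ?thesis .
  qed
  then show ?thesis using that[of "max B 0"] by simp
qed

section \<open>The quadratic form of the covariance\<close>

text \<open>
  The left side is a weighted geometric mean of \<open>a\<^sup>s b\<^sup>s\<close>, \<open>a\<^sup>s c\<^sup>r\<close> and \<open>b\<^sup>s c\<^sup>r\<close>, with weights \<open>1 - 2 \<tau>\<close>, \<open>\<tau>\<close> and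
  \<open>\<tau>\<close> where \<open>\<tau> = 1 - 1/s\<close>. Hence it is at most the largest of the three and a fortiori at most their
  sum. The condition \<open>s \<le> 2\<close> says that the first weight is nonnegative.
\<close>

lemma young_pointwise:
  fixes a b c s :: real
  assumes s: "1 < s" "s \<le> 2" and nonneg: "0 \<le> a" "0 \<le> b" "0 \<le> c"
  shows "a * c * b \<le> a powr s * b powr s + (a powr s + b powr s) * c powr (s / (2 * (s - 1)))"
proof (cases "a = 0 \<or> b = 0 \<or> c = 0")
  case True
  then show ?thesis by auto
next
  case False
  define r where "r = s / (2 * (s - 1))"
  define \<tau> where "\<tau> = 1 - 1 / s"
  define \<alpha> where "\<alpha> = ln a"
  define \<beta> where "\<beta> = ln b"
  define \<kappa> where "\<kappa> = ln c"
  have exp: "a = exp \<alpha>" "b = exp \<beta>" "c = exp \<kappa>"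
    using False nonneg by (auto simp: \<alpha>_def \<beta>_def \<kappa>_def)
  define A where "A = s * \<alpha> + s * \<beta>"
  define P where "P = s * \<alpha> + r * \<kappa>"
  define Q where "Q = s * \<beta> + r * \<kappa>"
  define m where "m = max A (max P Q)"
  have \<tau>: "0 \<le> \<tau>" "0 \<le> 1 - 2 * \<tau>" using s by (auto simp: \<tau>_def field_simps)
  have s\<tau>: "s * \<tau> = s - 1" using s by (simp add: \<tau>_def field_simps)
  have r\<tau>: "2 * (r * \<tau>) = 1" using s by (simp add: \<tau>_def r_def field_simps)
  have "\<alpha> + \<kappa> + \<beta> = (1 - 2 * \<tau>) * A + \<tau> * P + \<tau> * Q"
  proof -
    have "(1 - 2 * \<tau>) * A + \<tau> * P + \<tau> * Q = (s - s * \<tau>) * \<alpha> + (s - s * \<tau>) * \<beta> + 2 * (r * \<tau>) * \<kappa>"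
      by (simp add: A_def P_def Q_def algebra_simps)
    then show ?thesis by (simp add: s\<tau> r\<tau>)
  qed
  also have "\<dots> \<le> (1 - 2 * \<tau>) * m + \<tau> * m + \<tau> * m"
    using \<tau> by (intro add_mono mult_left_mono) (auto simp: m_def)
  also have "\<dots> = m" by (simp add: algebra_simps)
  finally have "exp (\<alpha> + \<kappa> + \<beta>) \<le> exp m" by simp
  also have "\<dots> \<le> exp A + exp P + exp Q"
    unfolding m_def max_def by (auto simp: add_nonneg_nonneg)
  also have "exp A + exp P + exp Q =
      a powr s * b powr s + (a powr s + b powr s) * c powr r"
    by (simp add: A_def P_def Q_def exp powr_def exp_add algebra_simps)
  also have "exp (\<alpha> + \<kappa> + \<beta>) = a * c * b"
    by (simp add: exp exp_add)
  finally show ?thesis unfolding r_def .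
qed

text \<open>
  Integration in \<open>y\<close> handles the term \<open>A x * k(x - y)\<close>; for \<open>A y * k(x - y)\<close> the order of integration is
  exchanged and the symmetry of the kernel is used.
\<close>

lemma torus_double_integral_bound:
  assumes "\<alpha> < 1"
  obtains L where "0 \<le> L"
    "\<And>A :: real ^ 'n \<Rightarrow> ennreal. A \<in> borel_measurable borel \<Longrightarrow>
      (\<integral>\<^sup>+x. \<integral>\<^sup>+y. A x * A y + (A x + A y) * ennreal (int_kernel \<alpha> (x - y)) \<partial>torus_measure \<partial>torus_measure)
      \<le> (\<integral>\<^sup>+x. A x \<partial>torus_measure)\<^sup>2 + ennreal L * (\<integral>\<^sup>+x. A x \<partial>torus_measure)"
proof -
  obtain L where L: "0 \<le> L" "\<And>x :: real ^ 'n. x \<in> cbox 0 One \<Longrightarrow>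
    (\<integral>\<^sup>+y. ennreal (int_kernel \<alpha> (x - y)) * indicator (cbox 0 One) y \<partial>lborel) \<le> ennreal L"
    by (rule nn_integral_int_kernel_bounded[OF assms, where ?'a = "real ^ 'n"]) blast
  define Q where "Q = (cbox 0 1 :: (real ^ 'n) set)"
  have Q [measurable]: "Q \<in> sets borel" by (simp add: Q_def)
  define k :: "real ^ 'n \<Rightarrow> ennreal" where "k z = ennreal (int_kernel \<alpha> z)" for z
  have [measurable]: "k \<in> borel_measurable borel" unfolding k_def by measurable
  have kL: "(\<integral>\<^sup>+y. k (x - y) * indicator Q y \<partial>lborel) \<le> ennreal L" if "x \<in> Q" for x
    using L(2)[of x] that unfolding Q_def k_def one_vec_eq_One .
  have kL': "(\<integral>\<^sup>+y. k (y - x) * indicator Q y \<partial>lborel) \<le> ennreal L" if "x \<in> Q" for x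
    using kL[OF that] int_kernel_uminus[of \<alpha> "x - _"] by (simp add: k_def)
  have "(\<integral>\<^sup>+x. \<integral>\<^sup>+y. A x * A y + (A x + A y) * k (x - y) \<partial>torus_measure \<partial>torus_measure)
      \<le> (\<integral>\<^sup>+x. A x \<partial>torus_measure)\<^sup>2 + ennreal (2 * L) * (\<integral>\<^sup>+x. A x \<partial>torus_measure)"
    if [measurable]: "A \<in> borel_measurable borel" for A :: "real ^ 'n \<Rightarrow> ennreal"
  proof -
    define B where "B x = A x * indicator Q x" for x
    have [measurable]: "B \<in> borel_measurable borel" unfolding B_def by measurable
    define S where "S = (\<integral>\<^sup>+x. B x \<partial>lborel)"
    have S: "(\<integral>\<^sup>+x. A x \<partial>torus_measure) = S"
      unfolding S_def B_def Q_def by (rule nn_integral_torus_measure)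
    define k' where "k' x y = k (x - y) * indicator Q x * indicator Q y" for x y
    have [measurable]: "(\<lambda>(x, y). k' x y) \<in> borel_measurable (lborel \<Otimes>\<^sub>M lborel)"
      unfolding k'_def split_beta by measurable
    have [measurable]: "k' x \<in> borel_measurable borel" "(\<lambda>x. k' x y) \<in> borel_measurable borel" for x y
      unfolding k'_def by measurable
    have inner: "(\<integral>\<^sup>+y. (A x * A y + (A x + A y) * k (x - y)) \<partial>torus_measure) * indicator Q x =
        B x * S + (B x * (\<integral>\<^sup>+y. k' x y \<partial>lborel) + (\<integral>\<^sup>+y. B y * k' x y \<partial>lborel))" for x
    proof -
      have "(\<integral>\<^sup>+y. (A x * A y + (A x + A y) * k (x - y)) \<partial>torus_measure) * indicator Q x =
         (\<integral>\<^sup>+y. (A x * A y + (A x + A y) * k (x - y)) * indicator Q y * indicator Q x \<partial>lborel)"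
        unfolding nn_integral_torus_measure Q_def[symmetric] by (rule nn_integral_multc[symmetric]) measurable
      also have "\<dots> = (\<integral>\<^sup>+y. B x * B y + (B x * k' x y + B y * k' x y) \<partial>lborel)"
        by (intro nn_integral_cong) (simp add: B_def k'_def indicator_def distrib_left distrib_right)
      also have "\<dots> = B x * S + (B x * (\<integral>\<^sup>+y. k' x y \<partial>lborel) + (\<integral>\<^sup>+y. B y * k' x y \<partial>lborel))"
        unfolding S_def by (simp add: nn_integral_add nn_integral_cmult)
      finally show ?thesis .
    qed
    have "(\<integral>\<^sup>+x. \<integral>\<^sup>+y. A x * A y + (A x + A y) * k (x - y) \<partial>torus_measure \<partial>torus_measure) =
        (\<integral>\<^sup>+x. B x * S + (B x * (\<integral>\<^sup>+y. k' x y \<partial>lborel) + (\<integral>\<^sup>+y. B y * k' x y \<partial>lborel)) \<partial>lborel)"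
      unfolding inner[symmetric] by (subst nn_integral_torus_measure) (simp add: Q_def)
    also have "\<dots> = S * S + ((\<integral>\<^sup>+x. B x * (\<integral>\<^sup>+y. k' x y \<partial>lborel) \<partial>lborel) + (\<integral>\<^sup>+x. \<integral>\<^sup>+y. B y * k' x y \<partial>lborel \<partial>lborel))"
      by (subst nn_integral_add; (subst nn_integral_add)?) (simp_all add: S_def nn_integral_multc)
    also have "(\<integral>\<^sup>+x. \<integral>\<^sup>+y. B y * k' x y \<partial>lborel \<partial>lborel) = (\<integral>\<^sup>+y. \<integral>\<^sup>+x. B y * k' x y \<partial>lborel \<partial>lborel)"
      by (rule lborel_pair.Fubini') measurable
    also have "\<dots> = (\<integral>\<^sup>+y. B y * (\<integral>\<^sup>+x. k' x y \<partial>lborel) \<partial>lborel)"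
      by (intro nn_integral_cong nn_integral_cmult) simp
    also have "(\<integral>\<^sup>+x. B x * (\<integral>\<^sup>+y. k' x y \<partial>lborel) \<partial>lborel) \<le> (\<integral>\<^sup>+x. B x * ennreal L \<partial>lborel)"
      using kL by (intro nn_integral_mono) (auto simp: k'_def B_def indicator_def intro!: mult_left_mono)
    also have "(\<integral>\<^sup>+y. B y * (\<integral>\<^sup>+x. k' x y \<partial>lborel) \<partial>lborel) \<le> (\<integral>\<^sup>+y. B y * ennreal L \<partial>lborel)"
      using kL' by (intro nn_integral_mono) (auto simp: k'_def B_def indicator_def intro!: mult_left_mono)
    also have "S * S + ((\<integral>\<^sup>+x. B x * ennreal L \<partial>lborel) + (\<integral>\<^sup>+y. B y * ennreal L \<partial>lborel)) = S\<^sup>2 + ennreal (2 * L) * S"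
    proof -
      have "(\<integral>\<^sup>+x. B x * ennreal L \<partial>lborel) = S * ennreal L"
        unfolding S_def by (rule nn_integral_multc) measurable
      moreover have "ennreal (2 * L) = ennreal L + ennreal L"
        using L by (simp flip: ennreal_plus)
      ultimately show ?thesis
        by (simp only: power2_eq_square distrib_left distrib_right mult.commute)
    qed
    finally show ?thesis unfolding S by (simp add: add_left_mono add_right_mono)
  qed
  then show ?thesis using that[of "2 * L"] L unfolding k_def by simp
qed

text \<open>
  The integrand is replaced by the Borel majorant that \<open>young\<close> provides before the double integral is
  rearranged, so the joint measurability of \<open>C (x - y)\<close> never enters. The majorant may fail on the
  null set of \<open>y\<close> for which \<open>x - y\<close> has an integer coordinate.
\<close>

lemma torus_inner_convolution_bound:
  fixes C :: "real ^ 'n \<Rightarrow> 'e \<Rightarrow>\<^sub>L 'e::euclidean_space"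
  assumes s: "0 < s" and "\<alpha> < 1" and B: "0 \<le> B"
    and C: "\<And>z. (\<And>b. b \<in> Basis \<Longrightarrow> z \<bullet> b \<notin> \<int>) \<Longrightarrow> norm (C z) \<le> B * k z"
    and young: "\<And>a b z. 0 \<le> a \<Longrightarrow> 0 \<le> b \<Longrightarrow>
       a * k z * b \<le> a powr s * b powr s + (a powr s + b powr s) * int_kernel \<alpha> z"
  obtains \<Phi> where "0 \<le> \<Phi>" and "\<And>D. continuous_on UNIV D \<Longrightarrow>
    (\<integral>x. norm (D x) powr s \<partial>torus_measure) \<le> 2 \<Longrightarrow> \<bar>torus_inner D (torus_convolution C D)\<bar> \<le> \<Phi>"
proof -
  obtain L where L: "0 \<le> L" "\<And>A :: real ^ 'n \<Rightarrow> ennreal. A \<in> borel_measurable borel \<Longrightarrow>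
      (\<integral>\<^sup>+x. \<integral>\<^sup>+y. A x * A y + (A x + A y) * ennreal (int_kernel \<alpha> (x - y)) \<partial>torus_measure \<partial>torus_measure)
      \<le> (\<integral>\<^sup>+x. A x \<partial>torus_measure)\<^sup>2 + ennreal L * (\<integral>\<^sup>+x. A x \<partial>torus_measure)"
    by (rule torus_double_integral_bound[OF \<open>\<alpha> < 1\<close>, where ?'n = 'n]) blast
  define \<Phi> where "\<Phi> = B * (4 + L * 2)"
  have "\<bar>torus_inner D (torus_convolution C D)\<bar> \<le> \<Phi>"
    if D: "continuous_on UNIV D" and S: "(\<integral>x. norm (D x) powr s \<partial>torus_measure) \<le> 2" for D :: "real ^ 'n \<Rightarrow> 'e"
  proof -
    define A where "A x = ennreal (norm (D x) powr s)" for x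
    have Dm [measurable]: "D \<in> borel_measurable borel" using D by (rule borel_measurable_continuous_onI)
    have [measurable]: "A \<in> borel_measurable borel" unfolding A_def by measurable
    define J where "J x y = A x * A y + (A x + A y) * ennreal (int_kernel \<alpha> (x - y))" for x y
    have [measurable]: "J x \<in> borel_measurable borel" "(\<lambda>(x, y). J x y) \<in> borel_measurable (lborel \<Otimes>\<^sub>M lborel)" for x
      unfolding J_def split_beta by measurable
    have "ennreal (norm (D x \<bullet> torus_convolution C D x)) \<le> (\<integral>\<^sup>+y. ennreal B * J x y \<partial>torus_measure)" for x
    proof -
      have "ennreal (norm (D x \<bullet> torus_convolution C D x)) \<le> ennreal (norm (D x)) * ennreal (norm (torus_convolution C D x))"
        by (simp add: Cauchy_Schwarz_ineq2 ennreal_mult[symmetric] ennreal_leI)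
      also have "\<dots> \<le> ennreal (norm (D x)) * (\<integral>\<^sup>+y. ennreal (norm (C (x - y) (D y))) \<partial>torus_measure)"
        unfolding torus_convolution_def by (intro mult_left_mono ennreal_norm_integral_le) simp
      also have "\<dots> = (\<integral>\<^sup>+y. ennreal (norm (D x)) * ennreal (norm (C (x - y) (D y))) \<partial>torus_measure)"
        by (rule nn_integral_cmult_real[symmetric]) simp
      also have "\<dots> \<le> (\<integral>\<^sup>+y. ennreal B * J x y \<partial>torus_measure)"
      proof (intro nn_integral_mono_AE)
        show "AE y in torus_measure. ennreal (norm (D x)) * ennreal (norm (C (x - y) (D y))) \<le> ennreal B * J x y"
          using AE_torus_not_Ints[of x]
        proof eventually_elim
          case (elim y)
          have "norm (D x) * norm (C (x - y) (D y)) \<le> norm (D x) * (norm (C (x - y)) * norm (D y))"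
            by (intro mult_left_mono norm_blinfun) simp
          also have "\<dots> \<le> norm (D x) * (B * k (x - y) * norm (D y))"
            using C[of "x - y"] elim by (intro mult_left_mono mult_right_mono) auto
          also have "\<dots> = B * (norm (D x) * k (x - y) * norm (D y))" by simp
          also have "\<dots> \<le> B * (norm (D x) powr s * norm (D y) powr s + (norm (D x) powr s + norm (D y) powr s) * int_kernel \<alpha> (x - y))"
            using B by (intro mult_left_mono young) auto
          finally have "ennreal (norm (D x) * norm (C (x - y) (D y))) \<le>
            ennreal (B * (norm (D x) powr s * norm (D y) powr s + (norm (D x) powr s + norm (D y) powr s) * int_kernel \<alpha> (x - y)))"
            by (rule ennreal_leI)
          also have "\<dots> = ennreal B * J x y"
            using B by (simp add: J_def A_def ennreal_mult ennreal_plus int_kernel_nonneg)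
          finally show ?case by (simp add: ennreal_mult)
        qed
      qed
      finally show ?thesis .
    qed
    then have "(\<integral>\<^sup>+x. ennreal (norm (D x \<bullet> torus_convolution C D x)) \<partial>torus_measure) \<le>
        (\<integral>\<^sup>+x. \<integral>\<^sup>+y. ennreal B * J x y \<partial>torus_measure \<partial>torus_measure)"
      by (intro nn_integral_mono)
    also have "\<dots> = ennreal B * (\<integral>\<^sup>+x. \<integral>\<^sup>+y. J x y \<partial>torus_measure \<partial>torus_measure)"
      unfolding nn_integral_torus_measure mult.assoc
      by (simp add: nn_integral_cmult mult.assoc)
    also have "\<dots> \<le> ennreal B * ((\<integral>\<^sup>+x. A x \<partial>torus_measure)\<^sup>2 + ennreal L * (\<integral>\<^sup>+x. A x \<partial>torus_measure))"
      unfolding J_def by (intro mult_left_mono L(2)) auto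
    also have "(\<integral>\<^sup>+x. A x \<partial>torus_measure) = ennreal (\<integral>x. norm (D x) powr s \<partial>torus_measure)"
      unfolding A_def
    proof (rule nn_integral_eq_integral)
      have "continuous_on (cbox 0 1) (\<lambda>x. norm (D x) powr s)"
        using D s by (intro continuous_on_powr' continuous_on_norm continuous_on_const) (auto intro: continuous_on_subset)
      then show "integrable torus_measure (\<lambda>x. norm (D x) powr s)"
        unfolding torus_measure_def by (intro continuous_imp_integrable)
    qed simp
    also have "ennreal B * ((ennreal (\<integral>x. norm (D x) powr s \<partial>torus_measure))\<^sup>2 +
        ennreal L * ennreal (\<integral>x. norm (D x) powr s \<partial>torus_measure)) \<le> ennreal B * ((ennreal 2)\<^sup>2 + ennreal L * ennreal 2)"
      using S by (intro mult_left_mono add_mono power_mono ennreal_leI) auto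
    also have "\<dots> = ennreal \<Phi>"
      using B L by (simp add: \<Phi>_def ennreal_mult ennreal_plus power2_eq_square)
    finally have "ennreal \<bar>torus_inner D (torus_convolution C D)\<bar> \<le> ennreal \<Phi>"
      unfolding torus_inner_def
      using order_trans[OF ennreal_norm_integral_le[of torus_measure "\<lambda>x. D x \<bullet> torus_convolution C D x"]] by simp
    then show ?thesis using B L by (simp add: \<Phi>_def)
  qed
  moreover have "0 \<le> \<Phi>" using B L by (simp add: \<Phi>_def)
  ultimately show ?thesis using that by blast
qed

section \<open>The spectral gap inequality\<close>

lemma random_field_distributions:
  assumes "random_field M X" and "w \<in> space M"
  shows "X w \<in> distributions"
  using measurable_space[of X M distribution_space w] assms
  by (simp add: random_field_def distribution_space_def space_restrict_space)

lemma random_field_measurable: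
  assumes "random_field M X" and "\<phi> \<in> test_functions"
  shows "(\<lambda>w. X w \<phi>) \<in> borel_measurable M"
proof -
  have "X \<in> M \<rightarrow>\<^sub>M (\<Pi>\<^sub>M \<phi>\<in>test_functions. borel)"
    using assms(1) unfolding random_field_def distribution_space_def
    by (rule measurable_restrict_space2_iff[THEN iffD1, THEN conjunct1])
  then show ?thesis
    using assms(2) by (rule measurable_compose[OF _ measurable_component_singleton])
qed

lemma rms_le:
  assumes "(\<integral>\<^sup>+w. ennreal (\<bar>U w\<bar>\<^sup>2) \<partial>M) \<le> ennreal (e\<^sup>2) + ennreal c * (\<integral>\<^sup>+w. ennreal (\<bar>V w\<bar>\<^sup>2) \<partial>M)"
    and c: "0 \<le> c" and K: "1 \<le> K" "sqrt c \<le> K"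
  shows "rms M U \<le> ennreal K * (ennreal \<bar>e\<bar> + rms M V)"
proof (cases "(\<integral>\<^sup>+w. ennreal (\<bar>V w\<bar>\<^sup>2) \<partial>M) = \<infinity>")
  case True
  then show ?thesis using K by (simp add: rms_def ennreal_mult_top)
next
  case False
  define r where "r = enn2real (\<integral>\<^sup>+w. ennreal (\<bar>V w\<bar>\<^sup>2) \<partial>M)"
  have r: "0 \<le> r" "(\<integral>\<^sup>+w. ennreal (\<bar>V w\<bar>\<^sup>2) \<partial>M) = ennreal r"
    using False by (simp_all add: r_def less_top)
  define u where "u = (\<integral>\<^sup>+w. ennreal (\<bar>U w\<bar>\<^sup>2) \<partial>M)"
  have u: "u \<le> ennreal (e\<^sup>2 + c * r)"
    using assms(1) c r unfolding u_def[symmetric] by (simp add: ennreal_mult ennreal_plus)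
  then have "u \<noteq> \<infinity>" by (auto simp: top_unique)
  have "sqrt (enn2real u) \<le> sqrt (e\<^sup>2 + c * r)"
    using enn2real_leI[OF _ u] c r by simp
  also have "\<dots> \<le> sqrt (e\<^sup>2) + sqrt (c * r)"
    using c r by (intro sqrt_add_le_add_sqrt) auto
  also have "\<dots> \<le> K * \<bar>e\<bar> + K * sqrt r"
    using K r by (auto simp: real_sqrt_mult intro!: add_mono mult_right_mono)
      (use mult_right_mono[of 1 K "\<bar>e\<bar>"] in simp)
  finally have "sqrt (enn2real u) \<le> K * (\<bar>e\<bar> + sqrt r)" by (simp add: distrib_left)
  then have "ennreal (sqrt (enn2real u)) \<le> ennreal K * (ennreal \<bar>e\<bar> + ennreal (sqrt r))"
    using K r by (simp add: ennreal_leI flip: ennreal_mult ennreal_plus)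
  then show ?thesis
    using \<open>u \<noteq> \<infinity>\<close> r unfolding rms_def u_def[symmetric] r(2) by simp
qed

text \<open>
  The Poincare inequality applied to the centred variables \<open>X(\<phi> i) - \<mu> i\<close>: the variance that appears in
  it is that of \<open>X\<close> tested against \<open>cyl_deriv\<close>.
\<close>

lemma spectral_gapI:
  fixes X :: "'w \<Rightarrow> (real ^ 'n \<Rightarrow> 'e::euclidean_space) \<Rightarrow> real"
  assumes M: "prob_space M" and X: "random_field M X" and gauss: "gaussian_field M X" and \<Phi>: "0 \<le> \<Phi>"
    and var: "\<And>D. D \<in> test_functions \<Longrightarrow> covariance M (\<lambda>w. X w D) (\<lambda>w. X w D) \<le> \<Phi> * (N D)\<^sup>2"
  shows "spectral_gap M X N"
proof -
  interpret prob_space M by fact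
  define c where "c = pi\<^sup>2 / 8 * \<Phi>"
  have c: "0 \<le> c" using \<Phi> by (simp add: c_def)
  define K where "K = max 1 (sqrt c)"
  have "rms M (\<lambda>w. G (X w)) \<le>
       ennreal K * (ennreal \<bar>\<integral>w. G (X w) \<partial>M\<bar> + rms M (\<lambda>w. N (cyl_deriv m \<phi> f (X w))))"
    if cyl: "cylindrical m \<phi> f G" and bdd: "bounded (G ` distributions)" for m \<phi> f G
  proof -
    have \<phi>: "\<And>i. i < m \<Longrightarrow> \<phi> i \<in> test_functions" and f: "smooth_function m f"
      and G: "\<And>\<xi>. \<xi> \<in> distributions \<Longrightarrow> G \<xi> = f (\<lambda>i. \<xi> (\<phi> i))"
      using cyl by (auto simp: cylindrical_def)
    note Xd = random_field_distributions[OF X] and Xm = random_field_measurable[OF X]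
    define \<mu> where "\<mu> i = (\<integral>w. X w (\<phi> i) \<partial>M)" for i
    define Y where "Y i w = (if i < m then X w (\<phi> i) - \<mu> i else 0)" for i w
    have X_int: "integrable M (\<lambda>w. X w D)" if "D \<in> test_functions" for D
      using gauss that by (intro gaussian_variable_square_integrable(1) M Xm) (auto simp: gaussian_field_def)
    have Ym: "Y i \<in> borel_measurable M" for i
      using Xm[OF \<phi>, of i] by (cases "i < m") (auto simp: Y_def[abs_def])
    have Y_int: "integrable M (Y i)" for i
      using X_int[OF \<phi>, of i] by (cases "i < m") (auto simp: Y_def[abs_def])
    have Y_mean: "(\<integral>w. Y i w \<partial>M) = 0" for i
      using X_int[OF \<phi>, of i] by (cases "i < m") (auto simp: Y_def[abs_def] \<mu>_def prob_space)
    have centred: "(\<integral>w. (\<Sum>i<m. a i * Y i w) \<partial>M) = 0" for a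
      using Y_int Y_mean by (simp add: integral_sum)
    define D where "D a = (\<lambda>x. \<Sum>i<m. a i *\<^sub>R \<phi> i x)" for a
    have D: "D a \<in> test_functions" for a
      unfolding D_def by (rule test_functions_sum) (rule \<phi>)
    have XD: "X w (D a) = (\<Sum>i<m. a i * X w (\<phi> i))" if "w \<in> space M" for w a
      unfolding D_def by (rule distributions_sum[OF Xd[OF that] \<phi>])
    have XD_mean: "(\<integral>w. X w (D a) \<partial>M) = (\<Sum>i<m. a i * \<mu> i)" for a
    proof -
      have "(\<integral>w. X w (D a) \<partial>M) = (\<integral>w. (\<Sum>i<m. a i * X w (\<phi> i)) \<partial>M)"
        by (intro Bochner_Integration.integral_cong refl XD)
      also have "\<dots> = (\<Sum>i<m. a i * \<mu> i)"
        using X_int[OF \<phi>] by (simp add: integral_sum \<mu>_def)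
      finally show ?thesis .
    qed
    have YD: "(\<Sum>i<m. a i * Y i w) = X w (D a) - (\<Sum>i<m. a i * \<mu> i)" if "w \<in> space M" for w a
      by (simp add: XD[OF that] Y_def right_diff_distrib sum_subtractf)
    have Ygauss: "gaussian_variable M (\<lambda>w. \<Sum>i<m. a i * Y i w)" for a
    proof (rule gaussian_variable_cong)
      show "gaussian_variable M (\<lambda>w. X w (D a) - (\<Sum>i<m. a i * \<mu> i))"
        using gauss D by (intro gaussian_variable_shift M) (auto simp: gaussian_field_def)
    qed (simp add: YD)
    have Yvar: "(\<integral>w. (\<Sum>i<m. a i * Y i w)\<^sup>2 \<partial>M) = covariance M (\<lambda>w. X w (D a)) (\<lambda>w. X w (D a))" for a
      unfolding covariance_def XD_mean
      by (intro Bochner_Integration.integral_cong refl) (simp add: YD power2_eq_square)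
    have fG: "f (\<lambda>i. \<mu> i + Y i w) = G (X w)" if "w \<in> space M" for w
      unfolding G[OF Xd[OF that]] by (rule smooth_function_cong[OF f]) (simp add: Y_def)
    obtain B where B: "\<And>\<xi>. \<xi> \<in> distributions \<Longrightarrow> \<bar>G \<xi>\<bar> \<le> B"
      using bdd by (auto simp: bounded_iff)
    have fB: "\<bar>f (\<lambda>i. \<mu> i + Y i w)\<bar> \<le> B" if "w \<in> space M" for w
      using B[OF Xd[OF that]] by (simp add: fG[OF that])
    have "(\<integral>\<^sup>+w. ennreal ((G (X w))\<^sup>2) \<partial>M) = (\<integral>\<^sup>+w. ennreal ((f (\<lambda>i. \<mu> i + Y i w))\<^sup>2) \<partial>M)"
      by (intro nn_integral_cong) (simp add: fG)
    also have "\<dots> \<le> ennreal ((\<integral>w. f (\<lambda>i. \<mu> i + Y i w) \<partial>M)\<^sup>2) + ennreal (pi\<^sup>2 / 8) *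
      (\<integral>\<^sup>+w. ennreal (\<integral>w'. (\<Sum>i<m. coord_deriv i f (\<lambda>i. \<mu> i + Y i w) * Y i w')\<^sup>2 \<partial>M) \<partial>M)"
      by (intro gaussian_poincare[where B=B] M Ym Ygauss centred f fB) (simp_all add: Y_def)
    also have "(\<integral>w. f (\<lambda>i. \<mu> i + Y i w) \<partial>M) = (\<integral>w. G (X w) \<partial>M)"
      by (intro Bochner_Integration.integral_cong refl fG)
    also have "(\<integral>\<^sup>+w. ennreal (\<integral>w'. (\<Sum>i<m. coord_deriv i f (\<lambda>i. \<mu> i + Y i w) * Y i w')\<^sup>2 \<partial>M) \<partial>M) \<le>
        (\<integral>\<^sup>+w. ennreal \<Phi> * ennreal (\<bar>N (cyl_deriv m \<phi> f (X w))\<bar>\<^sup>2) \<partial>M)"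
    proof (intro nn_integral_mono)
      fix w assume w: "w \<in> space M"
      have "coord_deriv i f (\<lambda>i. \<mu> i + Y i w) = coord_deriv i f (\<lambda>j. X w (\<phi> j))" if "i < m" for i
        using that by (intro coord_deriv_cong[OF f]) (auto simp: Y_def)
      then have "D (\<lambda>i. coord_deriv i f (\<lambda>i. \<mu> i + Y i w)) = cyl_deriv m \<phi> f (X w)"
        by (auto simp: D_def cyl_deriv_def)
      then have "(\<integral>w'. (\<Sum>i<m. coord_deriv i f (\<lambda>i. \<mu> i + Y i w) * Y i w')\<^sup>2 \<partial>M) \<le>
          \<Phi> * (N (cyl_deriv m \<phi> f (X w)))\<^sup>2"
        using var[OF D, of "\<lambda>i. coord_deriv i f (\<lambda>i. \<mu> i + Y i w)"] by (simp add: Yvar)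
      then show "ennreal (\<integral>w'. (\<Sum>i<m. coord_deriv i f (\<lambda>i. \<mu> i + Y i w) * Y i w')\<^sup>2 \<partial>M) \<le>
          ennreal \<Phi> * ennreal (\<bar>N (cyl_deriv m \<phi> f (X w))\<bar>\<^sup>2)"
        using \<Phi> by (simp add: ennreal_leI flip: ennreal_mult)
    qed
    also have "\<dots> = ennreal \<Phi> * (\<integral>\<^sup>+w. ennreal (\<bar>N (cyl_deriv m \<phi> f (X w))\<bar>\<^sup>2) \<partial>M)"
      by (rule nn_integral_cmult_real[OF \<Phi>])
    finally have "(\<integral>\<^sup>+w. ennreal (\<bar>G (X w)\<bar>\<^sup>2) \<partial>M) \<le> ennreal ((\<integral>w. G (X w) \<partial>M)\<^sup>2) +
        ennreal (pi\<^sup>2 / 8) * (ennreal \<Phi> * (\<integral>\<^sup>+w. ennreal (\<bar>N (cyl_deriv m \<phi> f (X w))\<bar>\<^sup>2) \<partial>M))"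
      by (simp add: add_left_mono mult_left_mono)
    also have "\<dots> = ennreal ((\<integral>w. G (X w) \<partial>M)\<^sup>2) +
        ennreal c * (\<integral>\<^sup>+w. ennreal (\<bar>N (cyl_deriv m \<phi> f (X w))\<bar>\<^sup>2) \<partial>M)"
      unfolding c_def mult.assoc[symmetric] by (subst ennreal_mult) (use \<Phi> in auto)
    finally show ?thesis
      by (rule rms_le[OF _ c]) (simp_all add: K_def)
  qed
  then show ?thesis unfolding spectral_gap_def by blast
qed

text \<open>
  Both sides are quadratic in \<open>D\<close>, so one may normalise \<open>D\<close>. If the norm vanishes, the bound holds for
  every multiple of \<open>D\<close>, which forces the variance to be nonpositive.
\<close>

lemma covariance_le_Ls_norm:
  fixes X :: "'w \<Rightarrow> (real ^ 'n \<Rightarrow> 'e::euclidean_space) \<Rightarrow> real"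
  assumes X: "random_field M X" and s: "0 < s" and \<Phi>: "0 \<le> \<Phi>"
    and bound: "\<And>D. D \<in> test_functions \<Longrightarrow> (\<integral>x. norm (D x) powr s \<partial>torus_measure) \<le> 1 \<Longrightarrow>
       covariance M (\<lambda>w. X w D) (\<lambda>w. X w D) \<le> \<Phi>"
    and D: "D \<in> test_functions"
  shows "covariance M (\<lambda>w. X w D) (\<lambda>w. X w D) \<le> \<Phi> * (Ls_norm s D)\<^sup>2"
proof -
  define V where "V D = covariance M (\<lambda>w. X w D) (\<lambda>w. X w D)" for D
  define S where "S = (\<integral>x. norm (D x) powr s \<partial>torus_measure)"
  have V_scale: "V (\<lambda>x. c *\<^sub>R D x) = c\<^sup>2 * V D" for c
  proof -
    have lin: "X w (\<lambda>x. c *\<^sub>R D x) = c * X w D" if "w \<in> space M" for w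
      by (rule distributions_scale[OF random_field_distributions[OF X that] D])
    have mean: "(\<integral>w. X w (\<lambda>x. c *\<^sub>R D x) \<partial>M) = c * (\<integral>w. X w D \<partial>M)"
      by (subst integral_mult_right_zero[symmetric]) (intro Bochner_Integration.integral_cong refl lin)
    show ?thesis
      unfolding V_def covariance_def mean integral_mult_right_zero[symmetric]
      by (intro Bochner_Integration.integral_cong refl) (simp add: lin power2_eq_square algebra_simps)
  qed
  have scaled: "c\<^sup>2 * V D \<le> \<Phi>" if c: "0 < c" "c powr s * S \<le> 1" for c
  proof -
    have "(\<integral>x. norm (c *\<^sub>R D x) powr s \<partial>torus_measure) = c powr s * S"
      unfolding S_def using c by (simp add: powr_mult)
    then show ?thesis
      using bound[OF test_functions_scale[OF D, of c]] c V_scale[of c] by (simp add: V_def)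
  qed
  have S0: "0 \<le> S" unfolding S_def by (intro Bochner_Integration.integral_nonneg) simp
  show ?thesis
  proof (cases "S = 0")
    case True
    have "V D \<le> 0"
    proof (rule ccontr)
      assume "\<not> V D \<le> 0"
      then have "(sqrt ((\<Phi> + 1) / V D))\<^sup>2 * V D \<le> \<Phi>"
        using True \<Phi> by (intro scaled) auto
      then show False using \<open>\<not> V D \<le> 0\<close> \<Phi> by simp
    qed
    then show ?thesis using True by (simp add: Ls_norm_def S_def V_def)
  next
    case False
    then have S: "0 < S" using S0 by simp
    define L where "L = S powr (1 / s)"
    have L: "0 < L" using S by (simp add: L_def)
    have "(1 / L) powr s * S = 1"
      using S s by (simp add: L_def powr_divide powr_powr)
    then have "(1 / L)\<^sup>2 * V D \<le> \<Phi>"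
      using L by (intro scaled) auto
    then show ?thesis
      using L by (simp add: V_def[symmetric] Ls_norm_def S_def[symmetric] L_def[symmetric] power_divide field_simps)
  qed
qed

text \<open>
  The pointwise inequality holds for the exponent \<open>s\<close>, the conclusion for every \<open>s' \<ge> s\<close>: since
  \<open>a\<^sup>s \<le> 1 + a\<^sup>s\<^sup>'\<close> and the torus has measure one, \<open>\<integral> |D|\<^sup>s\<^sup>' \<le> 1\<close> implies \<open>\<integral> |D|\<^sup>s \<le> 2\<close>, which is the reason for the
  bound \<open>2\<close> in \<open>torus_inner_convolution_bound\<close>.
\<close>

lemma spectral_gap_of_young:
  fixes X :: "'w \<Rightarrow> (real ^ 'n \<Rightarrow> 'e::euclidean_space) \<Rightarrow> real"
    and C :: "real ^ 'n \<Rightarrow> 'e \<Rightarrow>\<^sub>L 'e"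
  assumes "prob_space M" and X: "random_field M X" and "gaussian_field M X"
    and cov: "\<And>D. D \<in> test_functions \<Longrightarrow>
       covariance M (\<lambda>w. X w D) (\<lambda>w. X w D) = torus_inner D (torus_convolution C D)"
    and B: "0 \<le> B" and C: "\<And>z. (\<And>b. b \<in> Basis \<Longrightarrow> z \<bullet> b \<notin> \<int>) \<Longrightarrow> norm (C z) \<le> B * k z"
    and s: "0 < s" "s \<le> s'" and "\<alpha> < 1"
    and young: "\<And>a b z. 0 \<le> a \<Longrightarrow> 0 \<le> b \<Longrightarrow>
       a * k z * b \<le> a powr s * b powr s + (a powr s + b powr s) * int_kernel \<alpha> z"
  shows "spectral_gap M X (Ls_norm s')"
proof -
  obtain \<Phi> where \<Phi>: "0 \<le> \<Phi>" and bound: "\<And>D. continuous_on UNIV D \<Longrightarrow>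
    (\<integral>x. norm (D x) powr s \<partial>torus_measure) \<le> 2 \<Longrightarrow> \<bar>torus_inner D (torus_convolution C D)\<bar> \<le> \<Phi>"
    by (rule torus_inner_convolution_bound[OF s(1) \<open>\<alpha> < 1\<close> B C young]) auto
  have s': "0 < s'" using s by simp
  have "covariance M (\<lambda>w. X w D) (\<lambda>w. X w D) \<le> \<Phi>"
    if D: "D \<in> test_functions" and S: "(\<integral>x. norm (D x) powr s' \<partial>torus_measure) \<le> 1" for D
  proof -
    note cont = test_functions_continuous[OF D, of UNIV]
    have le: "a powr s \<le> 1 + a powr s'" if "0 \<le> a" for a :: real
      using s that powr_mono[OF s(2), of a] powr_le1[of s a] by (cases "a \<le> 1") (auto intro: add_increasing2 add_increasing)
    have one: "integrable torus_measure (\<lambda>x :: real ^ 'n. 1 :: real)"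
      using integral_torus_one[where 'n = 'n] not_integrable_integral_eq by fastforce
    have "(\<integral>x. norm (D x) powr s \<partial>torus_measure) \<le> (\<integral>x. 1 + norm (D x) powr s' \<partial>torus_measure)"
      using integrable_torus_powr[OF cont s(1)] integrable_torus_powr[OF cont s'] one
      by (intro integral_mono le Bochner_Integration.integrable_add) auto
    also have "\<dots> = 1 + (\<integral>x. norm (D x) powr s' \<partial>torus_measure)"
      using integrable_torus_powr[OF cont s'] one
      by (subst Bochner_Integration.integral_add) (simp_all only: integral_torus_one)
    also have "\<dots> \<le> 2" using S by simp
    finally show ?thesis
      using bound[OF cont] cov[OF D] by (simp add: abs_le_iff)
  qed
  then have "covariance M (\<lambda>w. X w D) (\<lambda>w. X w D) \<le> \<Phi> * (Ls_norm s' D)\<^sup>2"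
    if "D \<in> test_functions" for D
    using that by (intro covariance_le_Ls_norm[OF X s' \<Phi>]) auto
  then show ?thesis
    by (rule spectral_gapI[OF \<open>prob_space M\<close> X \<open>gaussian_field M X\<close> \<Phi>])
qed

theorem propositionA2:
  fixes M :: "'w measure"
    and X :: "'w \<Rightarrow> (real ^ 'n \<Rightarrow> 'e::euclidean_space) \<Rightarrow> real"
    and C :: "real ^ 'n \<Rightarrow> 'e \<Rightarrow>\<^sub>L 'e"
    and \<gamma> :: real
  assumes "0 \<le> \<gamma>" and "\<gamma> < real CARD('n)"
    and "prob_space M" and "random_field M X" and "stationary M X" and "gaussian_field M X"
    and "torus_periodic C"
    and "C \<in> borel_measurable torus_measure" and "integrable torus_measure (\<lambda>x. norm (C x))"
    and "\<And>\<phi> \<psi>. \<phi> \<in> test_functions \<Longrightarrow> \<psi> \<in> test_functions \<Longrightarrow>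
           covariance M (\<lambda>w. X w \<phi>) (\<lambda>w. X w \<psi>) = torus_inner \<phi> (torus_convolution C \<psi>)"
    and "bdd_above ((\<lambda>x. torus_abs x powr \<gamma> * norm (C x)) ` (- int_lattice))"
  shows "(\<forall>s > 2 * real CARD('n) / (2 * real CARD('n) - \<gamma>). spectral_gap M X (Ls_norm s)) \<and>
         (\<gamma> = 0 \<longrightarrow> spectral_gap M X (Ls_norm 1))"
proof (intro conjI allI impI)
  define n where "n = real CARD('n)"
  have n: "0 < n" "\<gamma> < n" using assms(2) by (simp_all add: n_def)
  obtain B where B: "0 \<le> B" and C: "\<And>z. (\<And>b. b \<in> Basis \<Longrightarrow> z \<bullet> b \<notin> \<int>) \<Longrightarrow>
      norm (C z) \<le> B * int_kernel (\<gamma> / n) z"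
    unfolding n_def using norm_le_int_kernel[OF assms(1) assms(11)] by blast
  {
    fix s' assume s': "2 * real CARD('n) / (2 * real CARD('n) - \<gamma>) < s'"
    \<comment> \<open>The pointwise inequality is limited to exponents at most \<open>2\<close>, and \<open>2\<close> is admissible because \<open>\<gamma> < n\<close>.\<close>
    define s where "s = min s' 2"
    have s2n: "2 * n / (2 * n - \<gamma>) < s"
      using s' n by (simp add: s_def n_def[symmetric] field_simps)
    have "1 \<le> 2 * n / (2 * n - \<gamma>)"
      using n assms(1) by (simp add: field_simps)
    then have s1: "1 < s" using s2n by simp
    \<comment> \<open>The power \<open>r = s / (2 (s - 1))\<close> of the majorant is again a kernel of the same form.\<close>
    define \<alpha> where "\<alpha> = \<gamma> / n * (s / (2 * (s - 1)))"
    have "\<gamma> * s < n * (2 * (s - 1))"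
      using s2n n by (simp add: field_simps)
    then have "\<alpha> < 1"
      using n s1 by (simp add: \<alpha>_def)
    show "spectral_gap M X (Ls_norm s')"
    proof (rule spectral_gap_of_young[OF assms(3,4,6,10) B C])
      show "0 < s" "s \<le> s'" using s1 by (simp_all add: s_def)
      show "\<alpha> < 1" by fact
      show "a * int_kernel (\<gamma> / n) z * b \<le> a powr s * b powr s + (a powr s + b powr s) * int_kernel \<alpha> z"
        if "0 \<le> a" "0 \<le> b" for a b and z :: "real ^ 'n"
        using young_pointwise[OF s1 _ that int_kernel_nonneg[of "\<gamma> / n" z]]
        by (simp add: int_kernel_powr \<alpha>_def s_def)
    qed
  }
  assume \<gamma>: "\<gamma> = 0"
  show "spectral_gap M X (Ls_norm 1)"
  proof (rule spectral_gap_of_young[OF assms(3,4,6,10) B C, where s=1 and \<alpha>=0])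
    fix a b :: real and z :: "real ^ 'n"
    assume ab: "0 \<le> a" "0 \<le> b"
    have "int_kernel (\<gamma> / n) z \<le> 1"
      unfolding int_kernel_def \<gamma> by (intro prod_le_1) auto
    then have "a * int_kernel (\<gamma> / n) z * b \<le> a * 1 * b"
      using ab by (intro mult_left_mono mult_right_mono) auto
    also have "\<dots> \<le> a powr 1 * b powr 1 + (a powr 1 + b powr 1) * int_kernel 0 z"
      using ab int_kernel_nonneg[of 0 z] by simp
    finally show "a * int_kernel (\<gamma> / n) z * b \<le> a powr 1 * b powr 1 + (a powr 1 + b powr 1) * int_kernel 0 z" .
  qed auto
qed

end
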